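(* Let $n\ge1$, $a<b$, and let $\gamma=(\gamma_1,\dots,\gamma_{n+1}):[a,b]\to\mathbb{R}^{n+1}$, $\gamma\in C([a,b])\cap C^{n+1}((a,b))$, be such that all the leading principal minors of the $(n+1)\times(n+1)$ matrix $(\gamma'(t),\dots,\gamma^{(n+1)}(t))$ are positive for all $t\in(a,b)$. Let $B^{\sup},B^{\inf}$ be the functions on $\mathrm{conv}(\overline{\gamma}([a,b]))$ defined in the context. Then for all $x\in\mathrm{conv}(\overline{\gamma}([a,b]))$, $$\sup_{a\le Y\le b}\{\mathbb{E}\gamma_{n+1}(Y):\mathbb{E}\overline{\gamma}(Y)=x\}=B^{\sup}(x),\qquad \inf_{a\le Y\le b}\{\mathbb{E}\gamma_{n+1}(Y):\mathbb{E}\overline{\gamma}(Y)=x\}=B^{\inf}(x),$$ where the supremum and infimum are over all random variables $Y$ with values in $[a,b]$. Moreover, given $x\in\mathrm{conv}(\overline{\gamma}([a,b]))$, the supremum is attained by the random variable $\zeta(x)$ and the infimum by the random variable $\xi(x)$ defined as follows. Case 1: $n=2\ell-1$. Then $x=(1-\sum_{j=1}^{\ell}\beta_j)\overline{\gamma}(a)+\sum_{j=2}^{\ell}\beta_j\overline{\gamma}(x_j)+\beta_1\overline{\gamma}(b)$ for some $(\beta_1,\dots,\beta_\ell,x_2,\dots,x_\ell)\in\Delta_c^{\ell}\times\Delta_*^{\ell-1}$; set $\mathbb{P}(\zeta(x)=a)=1-\sum_{j=1}^\ell\beta_j$, $\mathbb{P}(\zeta(x)=b)=\beta_1$, and $\mathbb{P}(\zeta(x)=x_j)=\beta_j$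 for $j=2,\dots,\ell$. Also $x=(1-\sum_{j=2}^{\ell}\lambda_j)\overline{\gamma}(y_1)+\sum_{j=2}^{\ell}\lambda_j\overline{\gamma}(y_j)$ for some $(\lambda_2,\dots,\lambda_\ell,y_1,\dots,y_\ell)\in\Delta_c^{\ell-1}\times\Delta_*^{\ell}$; set $\mathbb{P}(\xi(x)=y_1)=1-\sum_{j=2}^\ell\lambda_j$ and $\mathbb{P}(\xi(x)=y_j)=\lambda_j$ for $j=2,\dots,\ell$. Case 2: $n=2\ell$. Then $x=\sum_{j=1}^{\ell}\beta_j\overline{\gamma}(x_j)+(1-\sum_{j=1}^{\ell}\beta_j)\overline{\gamma}(b)$ for some $(\beta_1,\dots,\beta_\ell,x_1,\dots,x_\ell)\in\Delta_c^{\ell}\times\Delta_*^{\ell}$; set $\mathbb{P}(\zeta(x)=b)=1-\sum_{j=1}^\ell\beta_j$ and $\mathbb{P}(\zeta(x)=x_j)=\beta_j$ for $j=1,\dots,\ell$. Also $x=(1-\sum_{j=1}^{\ell}\lambda_j)\overline{\gamma}(a)+\sum_{j=1}^{\ell}\lambda_j\overline{\gamma}(y_j)$ for some $(\lambda_1,\dots,\lambda_\ell,y_1,\dots,y_\ell)\in\Delta_c^{\ell}\times\Delta_*^{\ell}$; set $\mathbb{P}(\xi(x)=a)=1-\sum_{j=1}^\ell\lambda_j$ and $\mathbb{P}(\xi(x)=y_j)=\lambda_j$ for $j=1,\dots,\ell$. (If some of the listed points coincide, the corresponding probabilities are added, i.e. the law is the corresponding weighted sum of Dirac masses.)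
   Context: $\overline{\gamma}=(\gamma_1,\dots,\gamma_n)$, $\mathrm{conv}$ is convex hull, and $\mathbb{E}\overline{\gamma}(Y)=(\mathbb{E}\gamma_1(Y),\dots,\mathbb{E}\gamma_n(Y))$. Set $$\Delta_c^k=\{(r_1,\dots,r_k)\in\mathbb{R}^k: r_j\ge0,\ r_1+\dots+r_k\le1\},\qquad \Delta_*^k=\{(y_1,\dots,y_k)\in\mathbb{R}^k: a\le y_1\le\dots\le y_k\le b\}$$ ($\Delta_c^0,\Delta_*^0$ are single points; empty sums are $0$). The functions $B^{\sup},B^{\inf}:\mathrm{conv}(\overline{\gamma}([a,b]))\to\mathbb{R}$ are defined as follows (under the present hypotheses on $\gamma$ these formulas define functions unambiguously on all of $\mathrm{conv}(\overline{\gamma}([a,b]))$). If $n=2\ell$: for all $(\lambda_1,\dots,\lambda_\ell,x_1,\dots,x_\ell)\in\Delta_c^\ell\times\Delta_*^\ell$, $$B^{\sup}\Big(\sum_{j=1}^\ell\lambda_j\overline{\gamma}(x_j)+\big(1-\sum_{j=1}^\ell\lambda_j\big)\overline{\gamma}(b)\Big)=\sum_{j=1}^\ell\lambda_j\gamma_{n+1}(x_j)+\big(1-\sum_{j=1}^\ell\lambda_j\big)\gamma_{n+1}(b),$$ $$B^{\inf}\Big(\big(1-\sum_{j=1}^\ell\lambda_j\big)\overline{\gamma}(a)+\sum_{j=1}^\ell\lambda_j\overline{\gamma}(x_j)\Big)=\big(1-\sum_{j=1}^\ell\lambda_j\big)\gamma_{n+1}(a)+\sum_{j=1}^\ell\lambda_j\gamma_{n+1}(x_j).$$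 If $n=2\ell-1$: for all $(\beta_1,\dots,\beta_\ell,x_2,\dots,x_\ell)\in\Delta_c^\ell\times\Delta_*^{\ell-1}$, $$B^{\sup}\Big(\big(1-\sum_{j=1}^\ell\beta_j\big)\overline{\gamma}(a)+\sum_{j=2}^\ell\beta_j\overline{\gamma}(x_j)+\beta_1\overline{\gamma}(b)\Big)=\big(1-\sum_{j=1}^\ell\beta_j\big)\gamma_{n+1}(a)+\sum_{j=2}^\ell\beta_j\gamma_{n+1}(x_j)+\beta_1\gamma_{n+1}(b),$$ and for all $(\beta_2,\dots,\beta_\ell,x_1,\dots,x_\ell)\in\Delta_c^{\ell-1}\times\Delta_*^{\ell}$, $$B^{\inf}\Big(\big(1-\sum_{j=2}^\ell\beta_j\big)\overline{\gamma}(x_1)+\sum_{j=2}^\ell\beta_j\overline{\gamma}(x_j)\Big)=\big(1-\sum_{j=2}^\ell\beta_j\big)\gamma_{n+1}(x_1)+\sum_{j=2}^\ell\beta_j\gamma_{n+1}(x_j).$$ *)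

theory Defs
  imports "HOL-Probability.Probability" "Jordan_Normal_Form.Determinant"
begin

text \<open>
  The full curve is \<open>\<gamma> :: nat \<Rightarrow> real \<Rightarrow> real\<close>, of which only \<open>\<gamma> 1, \<dots>, \<gamma> (n + 1)\<close> on \<open>{a..b}\<close>
  matter. The space of dimension \<open>n\<close> is \<open>real ^ 'n\<close> with \<open>n = CARD('n)\<close>; the linear order on \<open>'n\<close>
  numbers the coordinates, the index \<open>i\<close> being the one with number \<open>card {..i} \<in> {1..n}\<close>.
\<close>

definition curve :: "(nat \<Rightarrow> real \<Rightarrow> real) \<Rightarrow> real \<Rightarrow> real ^ ('n::{finite,linorder})" where
  "curve \<gamma> t = (\<chi> i. \<gamma> (card {..i}) t)"

definition Ck_on :: "nat \<Rightarrow> (real \<Rightarrow> real) \<Rightarrow> real set \<Rightarrow> bool" where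
  "Ck_on k f S \<longleftrightarrow>
     (\<forall>m<k. \<forall>t\<in>S. (deriv ^^ m) f field_differentiable (at t)) \<and> continuous_on S ((deriv ^^ k) f)"

text \<open>Column \<open>j\<close> of the following matrix is the derivative of order \<open>j + 1\<close>
  (rows and columns are counted from \<open>0\<close>).\<close>

definition deriv_matrix :: "nat \<Rightarrow> (nat \<Rightarrow> real \<Rightarrow> real) \<Rightarrow> real \<Rightarrow> real mat" where
  "deriv_matrix N \<gamma> t = Matrix.mat N N (\<lambda>(i, j). (deriv ^^ (j + 1)) (\<gamma> (i + 1)) t)"

definition leading_principal_minor :: "real mat \<Rightarrow> nat \<Rightarrow> real" where
  "leading_principal_minor A k = Determinant.det (Matrix.mat k k (\<lambda>(i, j). A $$ (i, j)))"

text \<open>\<open>\<Delta>\<^sub>c\<close> and \<open>\<Delta>\<^sub>*\<close>, with coordinates labelled by a finite set \<open>I\<close> of naturals; values outside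
  \<open>I\<close> are irrelevant.\<close>

definition Delta_c :: "nat set \<Rightarrow> (nat \<Rightarrow> real) set" where
  "Delta_c I = {r. (\<forall>j\<in>I. 0 \<le> r j) \<and> (\<Sum>j\<in>I. r j) \<le> 1}"

definition Delta_ord :: "real \<Rightarrow> real \<Rightarrow> nat set \<Rightarrow> (nat \<Rightarrow> real) set" where
  "Delta_ord a b I = {y. (\<forall>j\<in>I. a \<le> y j \<and> y j \<le> b) \<and> mono_on I y}"

text \<open>
  Parameters \<open>(\<beta>, y)\<close> of the two families of representations, and the lists of pairs (point, weight)
  they describe. Here \<open>n = 2 l\<close> or \<open>n = 2 l - 1\<close>, that is \<open>l = (n + 1) div 2\<close> in both cases.
\<close>

definition sup_params :: "nat \<Rightarrow> real \<Rightarrow> real \<Rightarrow> ((nat \<Rightarrow> real) \<times> (nat \<Rightarrow> real)) set" where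
  "sup_params n a b = (let l = (n + 1) div 2 in
     if even n then Delta_c {1..l} \<times> Delta_ord a b {1..l}
     else Delta_c {1..l} \<times> Delta_ord a b {2..l})"

definition sup_atoms ::
  "nat \<Rightarrow> real \<Rightarrow> real \<Rightarrow> (nat \<Rightarrow> real) \<Rightarrow> (nat \<Rightarrow> real) \<Rightarrow> (real \<times> real) list" where
  "sup_atoms n a b \<beta> y = (let l = (n + 1) div 2 in
     if even n then map (\<lambda>j. (y j, \<beta> j)) [1..<l + 1] @ [(b, 1 - (\<Sum>j=1..l. \<beta> j))]
     else (a, 1 - (\<Sum>j=1..l. \<beta> j)) # map (\<lambda>j. (y j, \<beta> j)) [2..<l + 1] @ [(b, \<beta> 1)])"

definition inf_params :: "nat \<Rightarrow> real \<Rightarrow> real \<Rightarrow> ((nat \<Rightarrow> real) \<times> (nat \<Rightarrow> real)) set" where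
  "inf_params n a b = (let l = (n + 1) div 2 in
     if even n then Delta_c {1..l} \<times> Delta_ord a b {1..l}
     else Delta_c {2..l} \<times> Delta_ord a b {1..l})"

definition inf_atoms ::
  "nat \<Rightarrow> real \<Rightarrow> real \<Rightarrow> (nat \<Rightarrow> real) \<Rightarrow> (nat \<Rightarrow> real) \<Rightarrow> (real \<times> real) list" where
  "inf_atoms n a b \<beta> y = (let l = (n + 1) div 2 in
     if even n then (a, 1 - (\<Sum>j=1..l. \<beta> j)) # map (\<lambda>j. (y j, \<beta> j)) [1..<l + 1]
     else (y 1, 1 - (\<Sum>j=2..l. \<beta> j)) # map (\<lambda>j. (y j, \<beta> j)) [2..<l + 1])"

definition weighted_sum :: "(real \<Rightarrow> 'v) \<Rightarrow> (real \<times> real) list \<Rightarrow> 'v::real_vector" where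
  "weighted_sum f ps = (\<Sum>(t, w)\<leftarrow>ps. w *\<^sub>R f t)"

text \<open>
  \<open>B_sup\<close> and \<open>B_inf\<close> send \<open>\<Sum> w \<gamma>(t)\<close> (the first \<open>n\<close> coordinates) to \<open>\<Sum> w \<gamma>\<^sub>n\<^sub>+\<^sub>1(t)\<close>, both sums over
  the atoms given by any admissible parameters. Outside the convex hull of the curve the values are
  unspecified.
\<close>

definition B_sup ::
  "real \<Rightarrow> real \<Rightarrow> (nat \<Rightarrow> real \<Rightarrow> real) \<Rightarrow> real ^ ('n::{finite,linorder}) \<Rightarrow> real" where
  "B_sup a b \<gamma> x = (THE v. \<exists>(\<beta>, y) \<in> sup_params CARD('n) a b.
     x = weighted_sum (curve \<gamma>) (sup_atoms CARD('n) a b \<beta> y) \<and>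
     v = weighted_sum (\<gamma> (CARD('n) + 1)) (sup_atoms CARD('n) a b \<beta> y))"

definition B_inf ::
  "real \<Rightarrow> real \<Rightarrow> (nat \<Rightarrow> real \<Rightarrow> real) \<Rightarrow> real ^ ('n::{finite,linorder}) \<Rightarrow> real" where
  "B_inf a b \<gamma> x = (THE v. \<exists>(\<beta>, y) \<in> inf_params CARD('n) a b.
     x = weighted_sum (curve \<gamma>) (inf_atoms CARD('n) a b \<beta> y) \<and>
     v = weighted_sum (\<gamma> (CARD('n) + 1)) (inf_atoms CARD('n) a b \<beta> y))"

text \<open>Measurability into the restricted space includes \<open>Y \<omega> \<in> {a..b}\<close> for every \<open>\<omega> \<in> space M\<close>.\<close>

definition rv_in :: "real \<Rightarrow> real \<Rightarrow> 'w measure \<Rightarrow> ('w \<Rightarrow> real) \<Rightarrow> bool" where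
  "rv_in a b M Y \<longleftrightarrow> prob_space M \<and> Y \<in> M \<rightarrow>\<^sub>M restrict_space borel {a..b}"

definition mean_curve ::
  "(nat \<Rightarrow> real \<Rightarrow> real) \<Rightarrow> 'w measure \<Rightarrow> ('w \<Rightarrow> real) \<Rightarrow> real ^ ('n::{finite,linorder})" where
  "mean_curve \<gamma> M Y = (\<chi> i. \<integral>\<omega>. \<gamma> (card {..i}) (Y \<omega>) \<partial>M)"

definition moment_values ::
  "'w itself \<Rightarrow> real \<Rightarrow> real \<Rightarrow> (nat \<Rightarrow> real \<Rightarrow> real) \<Rightarrow> real ^ ('n::{finite,linorder}) \<Rightarrow> real set" where
  "moment_values _ a b \<gamma> x =
     {\<integral>\<omega>. \<gamma> (CARD('n) + 1) (Y \<omega>) \<partial>M | (M :: 'w measure) Y. rv_in a b M Y \<and> mean_curve \<gamma> M Y = x}"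

text \<open>\<open>pmf_of_list\<close> adds the weights of coinciding points.\<close>

definition has_atoms ::
  "real \<Rightarrow> real \<Rightarrow> 'w measure \<Rightarrow> ('w \<Rightarrow> real) \<Rightarrow> (real \<times> real) list \<Rightarrow> bool" where
  "has_atoms a b M Y ps \<longleftrightarrow>
     rv_in a b M Y \<and> distr M borel Y = distr (measure_pmf (pmf_of_list ps)) borel (\<lambda>t. t)"

end

theory Submission
  imports Defs
begin

text \<open>
  Write \<open>n\<close> for the dimension and \<open>u\<^sub>0 = 1\<close>, \<open>u\<^sub>i = \<gamma>\<^sub>i\<close>. Positivity of the minors makes \<open>u\<^sub>0, \<dots>, u\<^sub>n\<close> and
  \<open>u\<^sub>0, \<dots>, u\<^sub>n\<^sub>+\<^sub>1\<close> Chebyshev systems on \<open>[a, b]\<close>: all determinants of \<open>u\<^sub>i (t\<^sub>j)\<close> at increasing points are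
  positive (\<open>minors_pos_imp_colloc_pos\<close>). The minors are Wronskians of the derivatives \<open>\<gamma>\<^sub>i'\<close>, and dividing by
  the first function and differentiating lowers the size of the system
  (\<open>wronskian_pos_imp_colloc_pos\<close>), while a mean value theorem for determinants (\<open>det_differences_pos\<close>)
  leads back from the derivatives to the functions.

  By separation, the mean of \<open>(\<gamma>\<^sub>1, \<dots>, \<gamma>\<^sub>n\<^sub>+\<^sub>1)\<close> under any law on \<open>[a, b]\<close> lies in the convex hull of the
  curve (\<open>mean_in_moment_space\<close>), a compact convex set; the theorem is about its highest and lowest point
  above \<open>x\<close>. At the highest point a supporting hyperplane gives a function \<open>Q = \<Sum> c\<^sub>i u\<^sub>i \<ge> 0\<close> with
  \<open>c\<^sub>n\<^sub>+\<^sub>1 \<le> 0\<close> that vanishes at all atoms of a representing measure. If there were too many atoms, then after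
  inserting further points between them one would have \<open>n + 2\<close> increasing points at which \<open>Q\<close>
  vanishes alternately; but the alternating sum of the values of \<open>Q\<close> at \<open>n + 2\<close> points, with suitable positive
  weights, is a positive multiple of \<open>c\<^sub>n\<^sub>+\<^sub>1\<close> (\<open>alternating_sum\<close>), and the signs do not fit. The
  number of atoms thus allowed (\<open>card_zeros_le\<close>) is exactly the one in the definition of \<open>B_sup\<close>, so the extremal
  measure is of the prescribed form (\<open>extremal_representation\<close>).

  Conversely, two measures of the prescribed form live together on at most \<open>n + 1\<close> points, where the values
  of \<open>u\<^sub>0, \<dots>, u\<^sub>n\<close> form a regular matrix; so \<open>x\<close> determines the measure
  (\<open>principal_representation_unique\<close>), and every representation in the prescribed form is extremal. The lowest
  point is treated in the same way with the signs reversed; a parameter \<open>e \<in> {0, 1}\<close> covers both cases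
  and both parities of \<open>n\<close>.
\<close>

section \<open>Collocation determinants, the mean value theorem and Wronskians\<close>

text \<open>
  Positivity of these determinants for all increasing points is the statement that \<open>f 0, \<dots>, f (N - 1)\<close>
  is a Chebyshev system.
\<close>

definition colloc :: "nat \<Rightarrow> (nat \<Rightarrow> real \<Rightarrow> real) \<Rightarrow> (nat \<Rightarrow> real) \<Rightarrow> real mat" where
  "colloc N f t = Matrix.mat N N (\<lambda>(i, j). f i (t j))"

lemma colloc_carrier [simp]: "colloc N f t \<in> carrier_mat N N"
  by (simp add: colloc_def)

lemma cofactor_cong_column:
  assumes "A \<in> carrier_mat n n" "B \<in> carrier_mat n n" "i < n" "j < n"
    and "\<And>i' j'. i' < n \<Longrightarrow> j' < n \<Longrightarrow> j' \<noteq> j \<Longrightarrow> A $$ (i', j') = B $$ (i', j')"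
  shows "Determinant.cofactor A i j = Determinant.cofactor B i j"
proof -
  have "mat_delete A i j = mat_delete B i j"
    using assms by (intro eq_matI) (auto simp: mat_delete_def)
  then show ?thesis by (simp add: Determinant.cofactor_def)
qed

lemma det_unit_first_row:
  fixes A :: "real mat"
  assumes A: "A \<in> carrier_mat (Suc k) (Suc k)"
    and "A $$ (0, 0) = 1" and "\<And>j. j < k \<Longrightarrow> A $$ (0, Suc j) = 0"
  shows "Determinant.det A = Determinant.det (Matrix.mat k k (\<lambda>(i, j). A $$ (Suc i, Suc j)))"
proof -
  have "mat_delete A 0 0 = Matrix.mat k k (\<lambda>(i, j). A $$ (Suc i, Suc j))"
    using A by (intro eq_matI) (auto simp: mat_delete_def)
  moreover have "Determinant.det A = (\<Sum>j<Suc k. A $$ (0, j) * Determinant.cofactor A 0 j)"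
    by (rule laplace_expansion_row[OF A]) simp
  ultimately show ?thesis
    using assms by (subst (asm) sum.lessThan_Suc_shift) (simp add: Determinant.cofactor_def)
qed

lemma det_upper_triangular_prod:
  fixes c :: "nat \<Rightarrow> nat \<Rightarrow> real"
  assumes "\<And>i j. j < i \<Longrightarrow> i < N \<Longrightarrow> c i j = 0"
  shows "Determinant.det (Matrix.mat N N (\<lambda>(i, j). c i j)) = (\<Prod>i<N. c i i)"
proof -
  have "Determinant.det (Matrix.mat N N (\<lambda>(i, j). c i j))
      = prod_list (diag_mat (Matrix.mat N N (\<lambda>(i, j). c i j)))"
    using assms by (intro det_upper_triangular[of _ N]) auto
  also have "\<dots> = (\<Prod>i<N. c i i)"
    unfolding prod_list_diag_prod by (auto intro!: prod.cong)
  finally show ?thesis .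
qed

text \<open>
  Subtracting from each column its left neighbour clears the row of ones except for its first entry.
\<close>

lemma det_colloc_differences:
  assumes one: "\<And>j. j \<le> k \<Longrightarrow> f 0 (t j) = 1"
  shows "Determinant.det (colloc (Suc k) f t)
       = Determinant.det (Matrix.mat k k (\<lambda>(i, j). f (Suc i) (t (Suc j)) - f (Suc i) (t j)))"
proof -
  define E where "E = Matrix.mat (Suc k) (Suc k)
    (\<lambda>(i, j). if i = j then 1 else if Suc i = j then -1 else (0::real))"
  define B where "B = Matrix.mat (Suc k) (Suc k)
    (\<lambda>(i, j). if j = 0 then f i (t 0) else f i (t j) - f i (t (j - 1)))"
  have [simp]: "E \<in> carrier_mat (Suc k) (Suc k)" "B \<in> carrier_mat (Suc k) (Suc k)"
    by (auto simp: E_def B_def)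
  have "colloc (Suc k) f t * E = B"
  proof (rule eq_matI)
    fix i j assume "i < dim_row B" "j < dim_col B"
    then have ij: "i < Suc k" "j < Suc k" by (auto simp: B_def)
    have "(colloc (Suc k) f t * E) $$ (i, j)
        = (\<Sum>l\<in>{0..<Suc k}. f i (t l) * (if l = j then 1 else if Suc l = j then -1 else 0))"
      using ij by (simp add: colloc_def E_def scalar_prod_def)
    also have "\<dots> = (\<Sum>l\<in>{0..<Suc k}. (if l = j then f i (t j) else 0)
        - (if j > 0 \<and> l = j - 1 then f i (t (j - 1)) else 0))"
      by (intro sum.cong) auto
    also have "\<dots> = B $$ (i, j)"
      using ij by (cases j) (auto simp: B_def sum_subtractf)
    finally show "(colloc (Suc k) f t * E) $$ (i, j) = B $$ (i, j)" .
  qed (auto simp: B_def colloc_def E_def)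
  then have "Determinant.det B = Determinant.det (colloc (Suc k) f t) * Determinant.det E"
    using det_mult[of "colloc (Suc k) f t" "Suc k" E] by simp
  also have "Determinant.det E = 1"
    unfolding E_def by (subst det_upper_triangular_prod) auto
  finally have "Determinant.det (colloc (Suc k) f t) = Determinant.det B" by simp
  also have "\<dots> = Determinant.det (Matrix.mat k k (\<lambda>(i, j). B $$ (Suc i, Suc j)))"
    using one by (intro det_unit_first_row) (auto simp: B_def)
  also have "Matrix.mat k k (\<lambda>(i, j). B $$ (Suc i, Suc j))
      = Matrix.mat k k (\<lambda>(i, j). f (Suc i) (t (Suc j)) - f (Suc i) (t j))"
    by (intro eq_matI) (auto simp: B_def)
  finally show ?thesis .
qed

text \<open>
  A multidimensional mean value theorem. As a function of the point in one column the determinant is a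
  linear combination of the \<open>f i\<close>, so the mean value theorem replaces the difference in that column by a
  positive multiple of the derivatives at an intermediate point. Doing this in every column leaves a
  collocation determinant of the derivatives, whose points are increasing because they lie in
  consecutive intervals. Nothing is differentiated at \<open>t 0\<close> or \<open>t k\<close>, which is what allows the points
  to include the endpoints of \<open>[a, b]\<close> later.
\<close>

lemma det_differences_pos:
  assumes t: "strict_mono_on {..k} t"
    and cont: "\<And>i. i < k \<Longrightarrow> continuous_on {t 0..t k} (f i)"
    and der: "\<And>i x. i < k \<Longrightarrow> x \<in> {t 0<..<t k} \<Longrightarrow> (f i has_real_derivative f' i x) (at x)"
    and pos: "\<And>s. strict_mono_on {..<k} s \<Longrightarrow> (\<And>j. j < k \<Longrightarrow> s j \<in> {t 0<..<t k}) \<Longrightarrow>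
                Determinant.det (colloc k f' s) > 0"
  shows "Determinant.det (Matrix.mat k k (\<lambda>(i, j). f i (t (Suc j)) - f i (t j))) > 0"
proof -
  have tle: "t i \<le> t j" if "i \<le> j" "j \<le> k" for i j
    using strict_mono_onD[OF t, of i j] that by (cases "i = j") auto
  \<comment> \<open>the first \<open>m\<close> columns are already differentiated, the others are still differences\<close>
  define mixed where "mixed m s = Matrix.mat k k
    (\<lambda>(i, j). if j < m then f' i (s j) else f i (t (Suc j)) - f i (t j))" for m s
  have mc [simp]: "mixed m s \<in> carrier_mat k k" for m s by (simp add: mixed_def)
  have *: "Determinant.det (mixed m s) > 0"
    if "m \<le> k" "\<And>j. j < m \<Longrightarrow> s j \<in> {t j<..<t (Suc j)}" for m s
    using that
  proof (induction "k - m" arbitrary: m s)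
    case 0
    then have [simp]: "m = k" by simp
    have sj: "s j \<in> {t j<..<t (Suc j)}" if "j < k" for j using 0 that by simp
    have "mixed m s = colloc k f' s"
      by (intro eq_matI) (auto simp: mixed_def colloc_def)
    moreover have "strict_mono_on {..<k} s"
    proof (rule strict_mono_onI)
      fix i j assume "i \<in> {..<k}" "j \<in> {..<k}" "i < j"
      then show "s i < s j" using sj[of i] sj[of j] tle[of "Suc i" j] by fastforce
    qed
    moreover have "s j \<in> {t 0<..<t k}" if "j < k" for j
      using sj[OF that] tle[of 0 j] tle[of "Suc j" k] that by auto
    ultimately show ?case using pos by simp
  next
    case (Suc d)
    then have m: "m < k" by simp
    define C where "C i = Determinant.cofactor (mixed m s) i m" for i
    define g where "g x = (\<Sum>i<k. f i x * C i)" for x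
    have tm: "t m < t (Suc m)" using strict_mono_onD[OF t, of m "Suc m"] m by simp
    have "t 0 \<le> t m" "t (Suc m) \<le> t k" using tle m by auto
    then have sub: "{t m..t (Suc m)} \<subseteq> {t 0..t k}" "{t m<..<t (Suc m)} \<subseteq> {t 0<..<t k}" by auto
    have "continuous_on {t m..t (Suc m)} g"
      unfolding g_def by (intro continuous_intros) (use cont sub continuous_on_subset in blast)
    moreover have dg: "(g has_real_derivative (\<Sum>i<k. f' i x * C i)) (at x)"
      if "t m < x" "x < t (Suc m)" for x
      unfolding g_def using der sub that by (intro DERIV_sum DERIV_cmult_right) auto
    ultimately obtain l x where x: "t m < x" "x < t (Suc m)" "DERIV g x :> l"
      "g (t (Suc m)) - g (t m) = (t (Suc m) - t m) * l"
      using MVT[OF tm] real_differentiable_def by metis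
    have l: "l = (\<Sum>i<k. f' i x * C i)" using dg[OF x(1,2)] x(3) DERIV_unique by blast
    have "Determinant.det (mixed m s) = (\<Sum>i<k. mixed m s $$ (i, m) * C i)"
      unfolding C_def by (rule laplace_expansion_column) (use m in auto)
    also have "\<dots> = g (t (Suc m)) - g (t m)"
      using m by (simp add: mixed_def g_def sum_subtractf[symmetric] left_diff_distrib)
    also have "\<dots> = (t (Suc m) - t m) * l" by (rule x)
    also have "l = Determinant.det (mixed (Suc m) (s(m := x)))"
    proof -
      have "Determinant.det (mixed (Suc m) (s(m := x))) = (\<Sum>i<k. mixed (Suc m) (s(m := x)) $$ (i, m)
          * Determinant.cofactor (mixed (Suc m) (s(m := x))) i m)"
        by (rule laplace_expansion_column) (use m in auto)
      also have "\<dots> = (\<Sum>i<k. f' i x * C i)"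
      proof (intro sum.cong refl)
        fix i assume "i \<in> {..<k}"
        then have i: "i < k" by simp
        have "Determinant.cofactor (mixed (Suc m) (s(m := x))) i m = C i"
          unfolding C_def by (rule cofactor_cong_column[of _ k]) (use m i in \<open>auto simp: mixed_def\<close>)
        then show "mixed (Suc m) (s(m := x)) $$ (i, m)
          * Determinant.cofactor (mixed (Suc m) (s(m := x))) i m = f' i x * C i"
          using m i by (simp add: mixed_def)
      qed
      finally show ?thesis using l by simp
    qed
    also have "(t (Suc m) - t m) * \<dots> > 0"
    proof (rule mult_pos_pos)
      show "Determinant.det (mixed (Suc m) (s(m := x))) > 0"
        by (rule Suc.hyps) (use Suc m x in \<open>auto simp: less_Suc_eq\<close>)
    qed (use tm in simp)
    finally show ?case .
  qed
  from *[of 0] show ?thesis by (simp add: mixed_def)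
qed

text \<open>
  The derivatives of \<open>f / g\<close>, for families \<open>f\<close> and \<open>g\<close> of successive derivatives: Leibniz' rule for
  \<open>f = (f / g) * g\<close>, solved for the term of highest order. In this form the matrix of derivatives of
  several functions \<open>f\<close> is the matrix of derivatives of the quotients times a triangular matrix.
\<close>

fun quotient_deriv :: "(nat \<Rightarrow> real \<Rightarrow> real) \<Rightarrow> (nat \<Rightarrow> real \<Rightarrow> real) \<Rightarrow> nat \<Rightarrow> real \<Rightarrow> real" where
  "quotient_deriv f g p x =
     (f p x - (\<Sum>q<p. real (p choose q) * quotient_deriv f g q x * g (p - q) x)) / g 0 x"

declare quotient_deriv.simps [simp del]

lemma quotient_deriv_leibniz:
  assumes "g 0 x \<noteq> 0"
  shows "f p x = (\<Sum>q\<le>p. real (p choose q) * quotient_deriv f g q x * g (p - q) x)"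
proof -
  have "quotient_deriv f g p x * g 0 x
      = f p x - (\<Sum>q<p. real (p choose q) * quotient_deriv f g q x * g (p - q) x)"
    using assms by (subst quotient_deriv.simps) simp
  then show ?thesis by (simp add: lessThan_Suc_atMost[symmetric])
qed

lemma quotient_deriv_self:
  assumes "g 0 x \<noteq> 0"
  shows "quotient_deriv g g p x = (if p = 0 then 1 else 0)"
proof (induction p rule: less_induct)
  case (less p)
  show ?case
  proof (cases "p = 0")
    case False
    have "(\<Sum>q<p. real (p choose q) * quotient_deriv g g q x * g (p - q) x)
        = (\<Sum>q<p. if q = 0 then g p x else 0)"
      using less by (intro sum.cong) auto
    also have "\<dots> = g p x" using False by simp
    finally show ?thesis using False by (subst quotient_deriv.simps) simp
  qed (use assms in \<open>subst quotient_deriv.simps, simp\<close>)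
qed

text \<open>
  By induction on the order: differentiate Leibniz' formula for order \<open>p\<close> and compare with the formula
  for order \<open>p + 1\<close>, using Pascal's rule.
\<close>

lemma has_derivative_quotient_deriv:
  assumes "open S" and nz: "\<And>x. x \<in> S \<Longrightarrow> g 0 x \<noteq> 0"
    and df: "\<And>p x. p < K \<Longrightarrow> x \<in> S \<Longrightarrow> (f p has_real_derivative f (Suc p) x) (at x)"
    and dg: "\<And>p x. p < K \<Longrightarrow> x \<in> S \<Longrightarrow> (g p has_real_derivative g (Suc p) x) (at x)"
    and "p < K" "x \<in> S"
  shows "(quotient_deriv f g p has_real_derivative quotient_deriv f g (Suc p) x) (at x)"
  using \<open>p < K\<close>
proof (induction p rule: less_induct)
  case (less p)
  let ?w = "quotient_deriv f g"
  let ?G = "\<lambda>q. real (p choose q) * (?w (Suc q) x * g (p - q) x + ?w q x * g (Suc p - q) x)"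
  have dsum: "((\<lambda>y. \<Sum>q<p. real (p choose q) * ?w q y * g (p - q) y) has_real_derivative sum ?G {..<p}) (at x)"
  proof (intro DERIV_sum)
    fix q assume "q \<in> {..<p}"
    then have "q < p" by simp
    then have "((\<lambda>y. real (p choose q) * (?w q y * g (p - q) y)) has_real_derivative
       real (p choose q) * (?w (Suc q) x * g (p - q) x + g (Suc (p - q)) x * ?w q x)) (at x)"
      using less dg \<open>x \<in> S\<close> by (intro DERIV_cmult DERIV_mult) auto
    then show "((\<lambda>y. real (p choose q) * ?w q y * g (p - q) y) has_real_derivative ?G q) (at x)"
      using \<open>q < p\<close> by (simp add: ac_simps Suc_diff_le)
  qed
  define D where "D = ((f (Suc p) x - sum ?G {..<p}) * g 0 x
    - (f p x - (\<Sum>q<p. real (p choose q) * ?w q x * g (p - q) x)) * g (Suc 0) x) / (g 0 x * g 0 x)"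
  have "((\<lambda>y. (f p y - (\<Sum>q<p. real (p choose q) * ?w q y * g (p - q) y)) / g 0 y)
      has_real_derivative D) (at x)"
    unfolding D_def using less.prems dsum df dg nz \<open>x \<in> S\<close>
    by (intro DERIV_divide DERIV_diff) auto
  then have 1: "(?w p has_real_derivative D) (at x)"
    by (subst quotient_deriv.simps[abs_def]) 
  have g0: "g 0 x \<noteq> 0" using nz \<open>x \<in> S\<close> by simp
  have 2: "D * g 0 x = f (Suc p) x - sum ?G {..<p} - ?w p x * g (Suc 0) x"
    unfolding D_def using g0 by (subst (2) quotient_deriv.simps) (simp add: field_simps)
  have 3: "f (Suc p) x = (\<Sum>q\<le>Suc p. real (Suc p choose q) * ?w q x * g (Suc p - q) x)"
    by (rule quotient_deriv_leibniz) (rule g0)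
  \<comment> \<open>Pascal's rule\<close>
  have 4: "(\<Sum>q\<le>Suc p. real (Suc p choose q) * ?w q x * g (Suc p - q) x) = sum ?G {..p}"
  proof -
    have "(\<Sum>q\<le>Suc p. real (Suc p choose q) * ?w q x * g (Suc p - q) x)
      = ?w 0 x * g (Suc p) x + (\<Sum>q\<le>p. real (p choose q) * ?w (Suc q) x * g (p - q) x)
        + (\<Sum>q\<le>p. real (p choose Suc q) * ?w (Suc q) x * g (p - q) x)"
      by (subst sum.atMost_Suc_shift) (simp add: sum.distrib[symmetric] algebra_simps)
    also have "(\<Sum>q\<le>p. real (p choose Suc q) * ?w (Suc q) x * g (p - q) x)
      = (\<Sum>q\<le>Suc p. real (p choose q) * ?w q x * g (Suc p - q) x) - ?w 0 x * g (Suc p) x"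
      by (subst sum.atMost_Suc_shift) simp
    also have "(\<Sum>q\<le>Suc p. real (p choose q) * ?w q x * g (Suc p - q) x)
      = (\<Sum>q\<le>p. real (p choose q) * ?w q x * g (Suc p - q) x)" by simp
    finally show ?thesis by (simp add: sum.distrib[symmetric] algebra_simps)
  qed
  have "D * g 0 x = ?w (Suc p) x * g 0 x"
    unfolding 2 3 4 by (simp add: lessThan_Suc_atMost[symmetric] algebra_simps)
  with 1 g0 show ?case by simp
qed

text \<open>
  The classical reduction of the order of a system with positive Wronskians. Dividing by \<open>v 0\<close> changes
  the collocation determinant and the Wronskians by positive factors and makes the first function
  constant; by the mean value lemma it then suffices to consider the derivatives of the remaining
  quotients, a system with one function less, whose Wronskians are those of the quotients.
\<close>

lemma wronskian_pos_imp_colloc_pos: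
  fixes v :: "nat \<Rightarrow> nat \<Rightarrow> real \<Rightarrow> real"
  assumes "\<And>i p x. i < k \<Longrightarrow> Suc p < k \<Longrightarrow> x \<in> {a<..<b} \<Longrightarrow>
             (v i p has_real_derivative v i (Suc p) x) (at x)"
    and "\<And>m x. m < k \<Longrightarrow> x \<in> {a<..<b} \<Longrightarrow>
             Determinant.det (Matrix.mat (Suc m) (Suc m) (\<lambda>(i, p). v i p x)) > 0"
    and "strict_mono_on {..<k} t" and "\<And>j. j < k \<Longrightarrow> t j \<in> {a<..<b}"
  shows "Determinant.det (colloc k (\<lambda>i. v i 0) t) > 0"
  using assms
proof (induction k arbitrary: v t)
  case 0
  then show ?case by (simp add: colloc_def)
next
  case (Suc k)
  note der = Suc.prems(1) and W = Suc.prems(2) and t = Suc.prems(3) and tab = Suc.prems(4)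
  have v0: "v 0 0 x > 0" if "x \<in> {a<..<b}" for x
    using W[of 0 x] that by (simp add: det_single)
  \<comment> \<open>\<open>w i p\<close> is the derivative of order \<open>p\<close> of \<open>v i / v 0\<close>\<close>
  define w where "w i = quotient_deriv (v i) (v 0)" for i
  have w0: "w 0 p x = (if p = 0 then 1 else 0)" if "x \<in> {a<..<b}" for p x
    unfolding w_def using v0[OF that] by (intro quotient_deriv_self) simp
  have leib: "v i p x = (\<Sum>q\<le>p. real (p choose q) * w i q x * v 0 (p - q) x)"
    if "x \<in> {a<..<b}" for i p x
    unfolding w_def using v0[OF that] by (intro quotient_deriv_leibniz) simp
  have dw: "(w i p has_real_derivative w i (Suc p) x) (at x)" if "i < Suc k" "p < k" "x \<in> {a<..<b}" for i p x
    unfolding w_def using der v0 that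
    by (intro has_derivative_quotient_deriv[where S = "{a<..<b}" and K = k]) (auto simp: less_imp_neq[symmetric])
  have IH: "Determinant.det (colloc k (\<lambda>i. w (Suc i) (Suc 0)) s) > 0"
    if s: "strict_mono_on {..<k} s" "\<And>j. j < k \<Longrightarrow> s j \<in> {a<..<b}" for s
  proof (rule Suc.IH[of "\<lambda>i p. w (Suc i) (Suc p)"])
    fix m x assume m: "m < k" and x: "x \<in> {a<..<b}"
    \<comment> \<open>the triangular matrix of Leibniz' rule: the Wronskian matrix of \<open>v\<close> is that of \<open>w\<close> times \<open>T\<close>\<close>
    define T where "T q p = (if q \<le> p then real (p choose q) * v 0 (p - q) x else 0)" for q p
    let ?M = "Suc (Suc m)"
    let ?w = "Matrix.mat ?M ?M (\<lambda>(i, q). w i q x)" and ?T = "Matrix.mat ?M ?M (\<lambda>(q, p). T q p)"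
    have "Matrix.mat ?M ?M (\<lambda>(i, p). v i p x) = ?w * ?T"
    proof (rule eq_matI)
      fix i p assume "i < dim_row (?w * ?T)" "p < dim_col (?w * ?T)"
      then have ip: "i < ?M" "p < ?M" by auto
      have "(?w * ?T) $$ (i, p) = (\<Sum>q\<in>{0..<?M}. w i q x * T q p)"
        using ip by (simp add: scalar_prod_def)
      also have "\<dots> = (\<Sum>q\<le>p. w i q x * T q p)"
        using ip by (intro sum.mono_neutral_right) (auto simp: T_def)
      also have "\<dots> = v i p x" by (subst leib[OF x]) (auto simp: T_def intro!: sum.cong)
      finally show "Matrix.mat ?M ?M (\<lambda>(i, p). v i p x) $$ (i, p) = (?w * ?T) $$ (i, p)"
        using ip by simp
    qed auto
    then have "Determinant.det (Matrix.mat ?M ?M (\<lambda>(i, p). v i p x)) = Determinant.det ?w * Determinant.det ?T"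
      using det_mult[of ?w ?M ?T] by simp
    also have "Determinant.det ?T = (\<Prod>i<?M. v 0 0 x)"
      by (subst det_upper_triangular_prod) (auto simp: T_def)
    finally have "Determinant.det ?w * (\<Prod>i<?M. v 0 0 x) > 0"
      using W[of "Suc m" x] m x by simp
    moreover have "(\<Prod>i<?M. v 0 0 x) > 0" using v0[OF x] by (intro prod_pos) simp
    ultimately have "Determinant.det ?w > 0" by (rule zero_less_mult_pos2)
    also have "Determinant.det ?w = Determinant.det (Matrix.mat (Suc m) (Suc m) (\<lambda>(i, j). ?w $$ (Suc i, Suc j)))"
      using w0[OF x] by (intro det_unit_first_row) auto
    also have "Matrix.mat (Suc m) (Suc m) (\<lambda>(i, j). ?w $$ (Suc i, Suc j))
       = Matrix.mat (Suc m) (Suc m) (\<lambda>(i, p). w (Suc i) (Suc p) x)"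
      by (intro eq_matI) auto
    finally show "Determinant.det (Matrix.mat (Suc m) (Suc m) (\<lambda>(i, p). w (Suc i) (Suc p) x)) > 0" .
  qed (use dw s in auto)
  have tk: "strict_mono_on {..k} t" using t by (simp add: lessThan_Suc_atMost)
  have "{t 0..t k} \<subseteq> {a<..<b}" using tab[of 0] tab[of k] by auto
  then have sub: "x \<in> {a<..<b}" if "x \<in> {t 0..t k}" for x using that by auto
  have "Determinant.det (Matrix.mat k k (\<lambda>(i, j). w (Suc i) 0 (t (Suc j)) - w (Suc i) 0 (t j))) > 0"
  proof (rule det_differences_pos[OF tk, where f' = "\<lambda>i. w (Suc i) (Suc 0)"])
    show "continuous_on {t 0..t k} (w (Suc i) 0)" if "i < k" for i
      using DERIV_isCont[OF dw[of "Suc i" 0]] that sub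
      by (intro continuous_at_imp_continuous_on) auto
    show "Determinant.det (colloc k (\<lambda>i. w (Suc i) (Suc 0)) s) > 0"
      if "strict_mono_on {..<k} s" "\<And>j. j < k \<Longrightarrow> s j \<in> {t 0<..<t k}" for s
    proof (rule IH)
      show "s j \<in> {a<..<b}" if "j < k" for j
        using \<open>\<And>j. j < k \<Longrightarrow> s j \<in> {t 0<..<t k}\<close>[OF that] sub[of "s j"] by auto
    qed (rule that)
  qed (use dw sub in auto)
  then have pos: "Determinant.det (colloc (Suc k) (\<lambda>i. w i 0) t) > 0"
    using w0 tab by (subst det_colloc_differences) auto
  let ?D = "Matrix.mat (Suc k) (Suc k) (\<lambda>(i, j). if i = j then v 0 0 (t j) else 0)"
  have "colloc (Suc k) (\<lambda>i. v i 0) t = colloc (Suc k) (\<lambda>i. w i 0) t * ?D"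
  proof (rule eq_matI)
    fix i j assume "i < dim_row (colloc (Suc k) (\<lambda>i. w i 0) t * ?D)" "j < dim_col (colloc (Suc k) (\<lambda>i. w i 0) t * ?D)"
    then have ij: "i < Suc k" "j < Suc k" by (auto simp: colloc_def)
    have "(colloc (Suc k) (\<lambda>i. w i 0) t * ?D) $$ (i, j)
        = (\<Sum>l\<in>{0..<Suc k}. w i 0 (t l) * (if l = j then v 0 0 (t j) else 0))"
      using ij by (simp add: colloc_def scalar_prod_def)
    also have "\<dots> = (\<Sum>l\<in>{0..<Suc k}. if l = j then w i 0 (t j) * v 0 0 (t j) else 0)"
      by (intro sum.cong) auto
    also have "\<dots> = v i 0 (t j)" using ij leib[OF tab[OF ij(2)], of i 0] by simp
    finally show "colloc (Suc k) (\<lambda>i. v i 0) t $$ (i, j) = (colloc (Suc k) (\<lambda>i. w i 0) t * ?D) $$ (i, j)"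
      using ij by (simp add: colloc_def)
  qed (auto simp: colloc_def)
  then have "Determinant.det (colloc (Suc k) (\<lambda>i. v i 0) t)
      = Determinant.det (colloc (Suc k) (\<lambda>i. w i 0) t) * Determinant.det ?D"
    using det_mult[of "colloc (Suc k) (\<lambda>i. w i 0) t" "Suc k" ?D] by simp
  also have "Determinant.det ?D = (\<Prod>j<Suc k. v 0 0 (t j))"
    by (subst det_upper_triangular_prod) auto
  also have "Determinant.det (colloc (Suc k) (\<lambda>i. w i 0) t) * \<dots> > 0"
    using pos v0 tab by (intro mult_pos_pos prod_pos) auto
  finally show ?case .
qed

section \<open>Zeros of nonnegative generalised polynomials\<close>

text \<open>
  The constant takes part in the system because a probability measure has total mass one.
\<close>

definition with_one :: "(nat \<Rightarrow> real \<Rightarrow> real) \<Rightarrow> nat \<Rightarrow> real \<Rightarrow> real" where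
  "with_one \<gamma> i t = (if i = 0 then 1 else \<gamma> i t)"

text \<open>
  The hypothesis on the minors says that the leading Wronskians of \<open>\<gamma>\<^sub>1', \<dots>, \<gamma>\<^sub>n\<^sub>+\<^sub>1'\<close> are positive, so these
  derivatives form Chebyshev systems on the open interval; one more use of the mean value lemma passes
  to \<open>1, \<gamma>\<^sub>1, \<dots>, \<gamma>\<^sub>k\<close> on the closed interval.
\<close>

lemma minors_pos_imp_colloc_pos:
  fixes \<gamma> :: "nat \<Rightarrow> real \<Rightarrow> real"
  assumes cont: "\<And>i. i \<in> {1..n+1} \<Longrightarrow> continuous_on {a..b} (\<gamma> i)"
    and smooth: "\<And>i. i \<in> {1..n+1} \<Longrightarrow> Ck_on (n+1) (\<gamma> i) {a<..<b}"
    and minors: "\<And>k t. k \<in> {1..n+1} \<Longrightarrow> t \<in> {a<..<b} \<Longrightarrow>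
                   leading_principal_minor (deriv_matrix (n+1) \<gamma> t) k > 0"
    and k: "k \<le> n + 1" and t: "strict_mono_on {..k} t" and tab: "\<And>j. j \<le> k \<Longrightarrow> t j \<in> {a..b}"
  shows "Determinant.det (colloc (Suc k) (with_one \<gamma>) t) > 0"
proof -
  define v where "v i p = (deriv ^^ (p + 1)) (\<gamma> (i + 1))" for i p
  have der: "((deriv ^^ p) (\<gamma> (i + 1)) has_real_derivative v i p x) (at x)"
    if "i < n + 1" "p < n + 1" "x \<in> {a<..<b}" for i p x
    using smooth[of "i + 1"] that unfolding Ck_on_def v_def
    by (auto simp: DERIV_deriv_iff_field_differentiable)
  have W: "Determinant.det (Matrix.mat (Suc m) (Suc m) (\<lambda>(i, p). v i p x)) > 0"
    if "m < n + 1" "x \<in> {a<..<b}" for m x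
  proof -
    have "Matrix.mat (Suc m) (Suc m) (\<lambda>(i, j). deriv_matrix (n + 1) \<gamma> x $$ (i, j))
        = Matrix.mat (Suc m) (Suc m) (\<lambda>(i, p). v i p x)"
      using that by (intro eq_matI) (auto simp: deriv_matrix_def v_def)
    then show ?thesis
      using minors[of "Suc m" x] that by (simp add: leading_principal_minor_def)
  qed
  have sub: "{t 0..t k} \<subseteq> {a..b}" "{t 0<..<t k} \<subseteq> {a<..<b}" using tab[of 0] tab[of k] by auto
  have "Determinant.det (Matrix.mat k k (\<lambda>(i, j). \<gamma> (Suc i) (t (Suc j)) - \<gamma> (Suc i) (t j))) > 0"
  proof (rule det_differences_pos[OF t, where f' = "\<lambda>i. v i 0"])
    show "continuous_on {t 0..t k} (\<gamma> (Suc i))" if "i < k" for i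
      using cont[of "Suc i"] that k sub(1) by (auto intro: continuous_on_subset)
    show "(\<gamma> (Suc i) has_real_derivative v i 0 x) (at x)" if "i < k" "x \<in> {t 0<..<t k}" for i x
      using der[of i 0 x] that k sub(2) by auto
    show "Determinant.det (colloc k (\<lambda>i. v i 0) s) > 0"
      if "strict_mono_on {..<k} s" "\<And>j. j < k \<Longrightarrow> s j \<in> {t 0<..<t k}" for s
    proof (rule wronskian_pos_imp_colloc_pos[of k a b v s])
      show "(v i p has_real_derivative v i (Suc p) x) (at x)"
        if "i < k" "Suc p < k" "x \<in> {a<..<b}" for i p x
        using der[of i "Suc p" x] that k by (simp add: v_def)
      show "s j \<in> {a<..<b}" if "j < k" for j
        using \<open>\<And>j. j < k \<Longrightarrow> s j \<in> {t 0<..<t k}\<close>[OF that] sub(2) by blast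
    qed (use that(1) W k in auto)
  qed
  then show ?thesis
    by (subst det_colloc_differences) (auto simp: with_one_def)
qed

lemma det_nonzero_kernel:
  fixes A :: "nat \<Rightarrow> nat \<Rightarrow> real"
  assumes det: "Determinant.det (Matrix.mat N N (\<lambda>(i, j). A i j)) \<noteq> 0"
    and ker: "\<And>i. i < N \<Longrightarrow> (\<Sum>j<N. A i j * c j) = 0"
    and j: "j < N"
  shows "c j = 0"
proof -
  let ?A = "Matrix.mat N N (\<lambda>(i, j). A i j)"
  have "?A *\<^sub>v Matrix.vec N c = 0\<^sub>v N"
    using ker by (intro eq_vecI) (auto simp: scalar_prod_def lessThan_atLeast0)
  then have "Matrix.vec N c = 0\<^sub>v N"
    using det det_0_iff_vec_prod_zero[of ?A N] mat_carrier vec_carrier by metis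
  then show ?thesis using j by (metis index_vec index_zero_vec(1))
qed

lemma strict_mono_on_from_Suc:
  fixes t :: "nat \<Rightarrow> real"
  assumes "\<And>j. j < N \<Longrightarrow> t j < t (Suc j)"
  shows "strict_mono_on {..N} t"
proof (rule strict_mono_onI)
  fix i j assume "i \<in> {..N}" "j \<in> {..N}" "i < j"
  then show "t i < t j"
  proof (induction j)
    case (Suc j)
    then show ?case using assms[of j] by (cases "i = j") auto
  qed simp
qed

text \<open>
  Both \<open>u 0, \<dots>, u n\<close> and \<open>u 0, \<dots>, u (n + 1)\<close> are Chebyshev systems on the closed interval. All that
  follows about zeros and uniqueness rests on these two facts.
\<close>

locale chebyshev_pair =
  fixes u :: "nat \<Rightarrow> real \<Rightarrow> real" and n :: nat and a b :: real
  assumes ab: "a < b"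
    and colloc_pos: "\<And>k t. k \<in> {n, n + 1} \<Longrightarrow> strict_mono_on {..k} t \<Longrightarrow>
          (\<And>j. j \<le> k \<Longrightarrow> t j \<in> {a..b}) \<Longrightarrow> Determinant.det (colloc (Suc k) u t) > 0"
begin

text \<open>
  Replace the last row of the collocation matrix by the values of \<open>\<Sum>i. c i * u i\<close>. By row operations the
  determinant is multiplied by the leading coefficient; on the other hand it can be expanded along that
  row, and the minors \<open>D j\<close> are collocation determinants of \<open>u 0, \<dots>, u n\<close>, hence positive.
\<close>

lemma alternating_sum:
  assumes t: "strict_mono_on {..n+1} t" and tab: "\<And>j. j \<le> n + 1 \<Longrightarrow> t j \<in> {a..b}"
  shows "\<exists>D D'. D' > 0 \<and> (\<forall>j\<le>n+1. D j > 0) \<and>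
    (\<forall>c. (\<Sum>j\<le>n+1. (-1) ^ (n + 1 + j) * D j * (\<Sum>i\<le>n+1. c i * u i (t j))) = c (n + 1) * D')"
proof -
  let ?N = "Suc (n + 1)"
  let ?M = "colloc ?N u t"
  define D where "D j = Determinant.det (colloc (Suc n) u (\<lambda>i. t (if i < j then i else Suc i)))" for j
  have D: "D j > 0" if "j \<le> n + 1" for j
    unfolding D_def
  proof (rule colloc_pos)
    show "strict_mono_on {..n} (\<lambda>i. t (if i < j then i else Suc i))"
      using that by (intro strict_mono_onI) (auto intro!: strict_mono_onD[OF t])
  qed (use tab in auto)
  have "(\<Sum>j\<le>n+1. (-1) ^ (n + 1 + j) * D j * (\<Sum>i\<le>n+1. c i * u i (t j)))
      = c (n + 1) * Determinant.det ?M" for c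
  proof -
    let ?L = "Matrix.mat ?N ?N (\<lambda>(i, j). if i = n + 1 then c j else if i = j then 1 else 0)"
    let ?R = "Matrix.mat ?N ?N (\<lambda>(i, j). if i = n + 1 then \<Sum>l\<le>n+1. c l * u l (t j) else u i (t j))"
    have "?R = ?L * ?M"
    proof (rule eq_matI)
      fix i j assume "i < dim_row (?L * ?M)" "j < dim_col (?L * ?M)"
      then have ij: "i < ?N" "j < ?N" by (auto simp: colloc_def)
      have "(?L * ?M) $$ (i, j)
         = (\<Sum>l\<le>n+1. (if i = n + 1 then c l else if i = l then 1 else 0) * u l (t j))"
        using ij by (simp add: scalar_prod_def colloc_def lessThan_atLeast0[symmetric]
             lessThan_Suc_atMost del: sum.atMost_Suc sum.lessThan_Suc)
      also have "\<dots> = ?R $$ (i, j)"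
      proof (cases "i = n + 1")
        case False
        then have "(\<Sum>l\<le>n+1. (if i = n + 1 then c l else if i = l then 1 else 0) * u l (t j))
            = (\<Sum>l\<le>n+1. if l = i then u i (t j) else 0)"
          by (intro sum.cong) auto
        then show ?thesis using ij False by (simp add: sum.delta del: sum.atMost_Suc)
      qed (use ij in simp)
      finally show "?R $$ (i, j) = (?L * ?M) $$ (i, j)" by simp
    qed (auto simp: colloc_def)
    then have "Determinant.det ?R = Determinant.det ?L * Determinant.det ?M"
      using det_mult[of ?L ?N ?M] by simp
    also have "Determinant.det ?L = prod_list (diag_mat ?L)"
      by (rule det_lower_triangular[of ?N]) auto
    also have "\<dots> = c (n + 1)"
      unfolding prod_list_diag_prod by (simp add: atLeast0_lessThan_Suc)
    finally have "Determinant.det ?R = c (n + 1) * Determinant.det ?M" .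
    moreover have "Determinant.det ?R = (\<Sum>j<?N. ?R $$ (n + 1, j) * Determinant.cofactor ?R (n + 1) j)"
      by (rule laplace_expansion_row[of _ ?N]) auto
    moreover have "\<dots> = (\<Sum>j\<le>n+1. (-1) ^ (n + 1 + j) * D j * (\<Sum>i\<le>n+1. c i * u i (t j)))"
      unfolding lessThan_Suc_atMost
    proof (intro sum.cong refl)
      fix j assume "j \<in> {..n+1}"
      then have j: "j < ?N" by simp
      have "mat_delete ?R (n + 1) j = colloc (Suc n) u (\<lambda>i. t (if i < j then i else Suc i))"
        using j by (intro eq_matI) (auto simp: mat_delete_def colloc_def)
      then show "?R $$ (n + 1, j) * Determinant.cofactor ?R (n + 1) j
          = (-1) ^ (n + 1 + j) * D j * (\<Sum>i\<le>n+1. c i * u i (t j))"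
        using j by (simp add: Determinant.cofactor_def D_def)
    qed
    ultimately show ?thesis by simp
  qed
  moreover have "Determinant.det ?M > 0" using colloc_pos[of "n + 1"] t tab by simp
  ultimately show ?thesis using D by blast
qed

lemma coefficients_zero:
  assumes t: "strict_mono_on {..n+1} t" and tab: "\<And>j. j \<le> n + 1 \<Longrightarrow> t j \<in> {a..b}"
    and zero: "\<And>j. j \<le> n + 1 \<Longrightarrow> (\<Sum>i\<le>n+1. c i * u i (t j)) = 0"
    and i: "i \<le> n + 1"
  shows "c i = 0"
proof (rule det_nonzero_kernel)
  let ?N = "Suc (n + 1)"
  have "Matrix.mat ?N ?N (\<lambda>(j, i). u i (t j)) = transpose_mat (colloc ?N u t)"
    by (intro eq_matI) (auto simp: colloc_def)
  moreover have "Determinant.det (colloc ?N u t) > 0"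
    using colloc_pos[of "n + 1"] t tab by simp
  ultimately show "Determinant.det (Matrix.mat ?N ?N (\<lambda>(j, i). u i (t j))) \<noteq> 0"
    by (simp add: det_transpose[of _ ?N])
  show "(\<Sum>i<?N. u i (t j) * c i) = 0" if "j < ?N" for j
    using zero[of j] that by (simp add: lessThan_Suc_atMost mult.commute del: sum.atMost_Suc sum.lessThan_Suc)
qed (use i in simp)

text \<open>
  Replaces the usual count of zeros with multiplicities, where an interior zero of a nonnegative function
  counts twice. Put a point between any two consecutive members of \<open>z\<close>. In the alternating sum over the
  resulting points every second value vanishes, and the remaining terms, all of the same sign, add up
  to a positive multiple of the leading coefficient, which is zero or of the opposite sign. So all values vanish,
  at more points than a nontrivial combination allows. With \<open>e = 1\<close> the points start at the first midpoint, and
  \<open>z 0\<close> only bounds it from below; likewise the last member of \<open>z\<close> may lie beyond the last point.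
\<close>

lemma interlaced_zeros_imp_zero:
  fixes c :: "nat \<Rightarrow> real" and z :: "nat \<Rightarrow> real"
  defines "Q \<equiv> \<lambda>t. \<Sum>i\<le>n+1. c i * u i t"
  assumes nonneg: "\<And>t. t \<in> {a..b} \<Longrightarrow> Q t \<ge> 0"
    and sign: "(-1) ^ (n + e) * c (n + 1) \<le> 0"
    and z: "strict_mono_on {..L} z" and zab: "\<And>i. i \<le> L \<Longrightarrow> z i \<in> {a..b}"
    and L: "n + 1 + e \<le> 2 * L"
    and zero: "\<And>i. e \<le> 2 * i \<Longrightarrow> 2 * i \<le> n + 1 + e \<Longrightarrow> Q (z i) = 0"
    and i: "i \<le> n + 1"
  shows "c i = 0"
proof -
  \<comment> \<open>the sequence \<open>z\<close> with all midpoints inserted\<close>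
  define zig where "zig m = (if even m then z (m div 2) else (z (m div 2) + z (Suc (m div 2))) / 2)" for m
  define t where "t j = zig (j + e)" for j
  have zz: "z i < z (Suc i)" if "i < L" for i using strict_mono_onD[OF z, of i "Suc i"] that by simp
  have "zig m < zig (Suc m)" if "m < 2 * L" for m
  proof (cases "even m")
    case True
    then have "m div 2 < L" using that by auto
    from zz[OF this] True show ?thesis by (simp add: zig_def)
  next
    case False
    then have "m div 2 < L" using that by auto
    from zz[OF this] False show ?thesis by (simp add: zig_def)
  qed
  then have t: "strict_mono_on {..n+1} t"
    using L by (intro strict_mono_on_from_Suc) (simp add: t_def)
  have tab: "t j \<in> {a..b}" if "j \<le> n + 1" for j
  proof (cases "even (j + e)")
    case True
    then show ?thesis using zab[of "(j + e) div 2"] that L by (auto simp: t_def zig_def)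
  next
    case False
    then have "Suc ((j + e) div 2) \<le> L" using that L by presburger
    then show ?thesis
      using zab[of "(j + e) div 2"] zab[of "Suc ((j + e) div 2)"] False by (auto simp: t_def zig_def)
  qed
  obtain D D' where D: "D' > 0" "\<forall>j\<le>n+1. D j > 0"
    and sum: "\<forall>c. (\<Sum>j\<le>n+1. (-1) ^ (n + 1 + j) * D j * (\<Sum>i\<le>n+1. c i * u i (t j))) = c (n + 1) * D'"
    using alternating_sum[OF t tab] by blast
  have Dpos: "D j > 0" if "j \<le> n + 1" for j using D(2) that by blast
  have even0: "Q (t j) = 0" if "j \<le> n + 1" "even (j + e)" for j
    using zero[of "(j + e) div 2"] that by (auto simp: t_def zig_def)
  \<comment> \<open>a point \<open>t j\<close> that is not one of the \<open>z i\<close> has \<open>j + e\<close> odd, so its sign \<open>(-1) ^ (n + 1 + j)\<close> is \<open>(-1) ^ (n + e)\<close>\<close>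
  have "(\<Sum>j\<le>n+1. D j * Q (t j)) = (\<Sum>j\<le>n+1. (-1) ^ (n + e) * ((-1) ^ (n + 1 + j) * D j * Q (t j)))"
  proof (intro sum.cong refl)
    fix j assume "j \<in> {..n+1}"
    then have j: "j \<le> n + 1" by simp
    show "D j * Q (t j) = (-1) ^ (n + e) * ((-1) ^ (n + 1 + j) * D j * Q (t j))"
    proof (cases "even (j + e)")
      case False
      then have "even ((n + e) + (n + 1 + j))" by presburger
      then have "(-1::real) ^ (n + e) * (-1) ^ (n + 1 + j) = 1"
        unfolding power_add[symmetric] by (rule neg_one_even_power)
      then show ?thesis by (simp add: mult.assoc[symmetric])
    qed (simp add: even0[OF j])
  qed
  also have "\<dots> = (-1) ^ (n + e) * (c (n + 1) * D')"
    unfolding sum_distrib_left[symmetric] Q_def by (simp only: sum[rule_format])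
  also have "\<dots> \<le> 0"
    using sign D(1) by (metis mult.assoc mult_nonpos_nonneg less_imp_le)
  finally have "(\<Sum>j\<le>n+1. D j * Q (t j)) \<le> 0" .
  moreover have nn: "D j * Q (t j) \<ge> 0" if "j \<in> {..n+1}" for j
    using that Dpos[of j] nonneg[OF tab[of j]] by simp
  ultimately have "(\<Sum>j\<le>n+1. D j * Q (t j)) = 0"
    using sum_nonneg[of "{..n+1}" "\<lambda>j. D j * Q (t j)"] by simp
  then have "\<forall>j\<in>{..n+1}. D j * Q (t j) = 0"
    using sum_nonneg_eq_0_iff[of "{..n+1}" "\<lambda>j. D j * Q (t j)"] nn by blast
  then have "Q (t j) = 0" if "j \<le> n + 1" for j
    using Dpos[OF that] that by (metis atMost_iff less_irrefl mult_eq_0_iff)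
  then show ?thesis using coefficients_zero[OF t tab _ i] by (simp add: Q_def)
qed

text \<open>
  The parameter \<open>e\<close> distinguishes the two extremal problems: the extremal measures for maximising
  \<open>(-1) ^ (n + e) * u (n + 1)\<close> may charge the points of \<open>endpoints e\<close> and \<open>free_points e\<close> further points. So \<open>e\<close>
  is the parity of \<open>n\<close> for the maximum of \<open>u (n + 1)\<close> and the opposite parity for its minimum.
\<close>

definition endpoints :: "nat \<Rightarrow> real set" where
  "endpoints e = (if e = 1 then {a} else {}) \<union> (if even (n + e) then {b} else {})"

definition free_points :: "nat \<Rightarrow> nat" where
  "free_points e = (n + 1 - e) div 2"

text \<open>
  The index of the extremal measures, in which an endpoint counts once and a free point twice, is \<open>n + 1\<close>.
\<close>

lemma twice_free_points:
  assumes "e \<le> 1"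
  shows "2 * free_points e + e + (if even (n + e) then 1 else 0) = n + 1"
proof -
  from assms consider "e = 0" | "e = 1" by linarith
  then show ?thesis by cases (simp_all add: free_points_def)
qed

lemma card_endpoints:
  assumes "e \<le> 1"
  shows "card (endpoints e) = e + (if even (n + e) then 1 else 0)"
  using assms ab by (auto simp: endpoints_def le_Suc_eq)

text \<open>
  With one zero more than allowed, these zeros together with the endpoints would be a sequence to which
  the preceding lemma applies: an endpoint in \<open>endpoints e\<close> is only ever used as a bound for an inserted
  midpoint.
\<close>

lemma card_zeros_le:
  fixes c :: "nat \<Rightarrow> real"
  defines "Q \<equiv> \<lambda>t. \<Sum>i\<le>n+1. c i * u i t"
  assumes e: "e \<le> 1"
    and nonneg: "\<And>t. t \<in> {a..b} \<Longrightarrow> Q t \<ge> 0"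
    and sign: "(-1) ^ (n + e) * c (n + 1) \<le> 0"
    and nz: "i \<le> n + 1" "c i \<noteq> 0"
    and Z: "Z \<subseteq> {a..b}" "\<And>z. z \<in> Z \<Longrightarrow> Q z = 0"
  shows "card (Z - endpoints e) \<le> free_points e"
proof (rule ccontr)
  assume "\<not> ?thesis"
  then obtain Z' where Z': "Z' \<subseteq> Z - endpoints e" "card Z' = Suc (free_points e)" "finite Z'"
    by (metis not_less_eq_eq obtain_subset_with_card_n)
  define X where "X = Z' \<union> endpoints e"
  define xs where "xs = sorted_list_of_set X"
  define L where "L = free_points e + e + (if even (n + e) then 1 else 0)"
  have "finite X" using Z'(3) by (auto simp: X_def endpoints_def)
  have "card X = Suc L"
    unfolding X_def L_def using Z' card_endpoints[OF e] by (subst card_Un_disjoint) (auto simp: endpoints_def)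
  then have len: "length xs = Suc L" by (simp add: xs_def)
  have setxs: "set xs = X" using \<open>finite X\<close> by (simp add: xs_def)
  have xs: "strict_mono_on {..L} (\<lambda>i. xs ! i)"
    using len strict_sorted_list_of_set[of X]
    by (intro strict_mono_onI) (auto simp: xs_def[symmetric] sorted_wrt_iff_nth_less)
  have "X \<subseteq> {a..b}" using Z Z' ab by (auto simp: X_def endpoints_def split: if_splits)
  then have xab: "xs ! i \<in> {a..b}" if "i \<le> L" for i
    using that len setxs nth_mem[of i xs] by auto
  have "n + 1 + e \<le> 2 * L"
    using twice_free_points[OF e] by (simp add: L_def split: if_splits)
  moreover have "Q (xs ! i) = 0" if i: "e \<le> 2 * i" "2 * i \<le> n + 1 + e" for i
  proof -
    \<comment> \<open>\<open>i\<close> avoids the first position if \<open>a\<close> was added to the zeros, and the last one if \<open>b\<close> was\<close>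
    have iL: "i \<le> L" and iL': "even (n + e) \<Longrightarrow> i < L"
      using i twice_free_points[OF e] by (auto simp: L_def split: if_splits)
    have "xs ! i \<noteq> a" if "e = 1"
      using strict_mono_onD[OF xs, of 0 i] xab[of 0] iL i that by (cases "i = 0") auto
    moreover have "xs ! i \<noteq> b" if "even (n + e)"
      using strict_mono_onD[OF xs, of i L] xab[of L] iL'[OF that] by auto
    moreover have "xs ! i \<in> X" using iL len setxs nth_mem[of i xs] by auto
    ultimately have "xs ! i \<in> Z'" by (auto simp: X_def endpoints_def split: if_splits)
    then show ?thesis using Z' Z by auto
  qed
  ultimately have "c i = 0"
    using interlaced_zeros_imp_zero[of c e L "\<lambda>i. xs ! i" i] nonneg sign xs xab nz(1)
    unfolding Q_def by blast
  with nz show False by simp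
qed

text \<open>
  Two signed measures of the extremal form charge together at most \<open>card (endpoints e) + 2 * free_points e = n + 1\<close>
  points. Extended to exactly \<open>n + 1\<close> points, these carry a regular collocation matrix of \<open>u 0, \<dots>, u n\<close>, so
  measures with equal moments coincide and integrate every \<open>g\<close> to the same value.
\<close>

lemma principal_representation_unique:
  fixes w w' :: "real \<Rightarrow> real"
  assumes e: "e \<le> 1"
    and T: "finite T" "T \<subseteq> {a..b}" "card (T - endpoints e) \<le> free_points e"
    and T': "finite T'" "T' \<subseteq> {a..b}" "card (T' - endpoints e) \<le> free_points e"
    and eq: "\<And>i. i \<le> n \<Longrightarrow> (\<Sum>t\<in>T. w t * u i t) = (\<Sum>t\<in>T'. w' t * u i t)"
  shows "(\<Sum>t\<in>T. w t * g t) = (\<Sum>t\<in>T'. w' t * g t)"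
proof -
  define S where "S = T \<union> T'"
  have fS: "finite S" "S \<subseteq> {a..b}" using T T' by (auto simp: S_def)
  have "card S \<le> card (endpoints e \<union> ((T - endpoints e) \<union> (T' - endpoints e)))"
    using T T' by (intro card_mono) (auto simp: S_def endpoints_def)
  also have "\<dots> \<le> card (endpoints e) + (card (T - endpoints e) + card (T' - endpoints e))"
    by (meson card_Un_le le_trans add_left_mono)
  also have "\<dots> \<le> card (endpoints e) + 2 * free_points e" using T T' by simp
  also have "\<dots> = Suc n"
    using card_endpoints[OF e] twice_free_points[OF e] by simp
  finally have cS: "card S \<le> Suc n" .
  \<comment> \<open>fill up with arbitrary points, to which the difference \<open>d\<close> of the weights assigns nothing\<close>
  have "infinite ({a..b} - S)" using ab fS by (simp add: infinite_Icc)
  then obtain S0 where S0: "S0 \<subseteq> {a..b} - S" "finite S0" "card S0 = Suc n - card S"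
    using infinite_arbitrarily_large by metis
  define X where "X = S \<union> S0"
  have X: "finite X" "X \<subseteq> {a..b}" "card X = Suc n" "T \<subseteq> X" "T' \<subseteq> X"
    unfolding X_def using S0 fS cS by (auto simp: S_def card_Un_disjoint) (subst card_Un_disjoint; auto)
  define xs where "xs = sorted_list_of_set X"
  have len: "length xs = Suc n" and setxs: "set xs = X" and "distinct xs"
    using X by (auto simp: xs_def)
  define d where "d t = (if t \<in> T then w t else 0) - (if t \<in> T' then w' t else 0)" for t
  have dsum: "(\<Sum>j<Suc n. d (xs ! j) * h (xs ! j)) = (\<Sum>t\<in>T. w t * h t) - (\<Sum>t\<in>T'. w' t * h t)" for h
  proof -
    have "(\<Sum>j<Suc n. d (xs ! j) * h (xs ! j)) = (\<Sum>t\<in>X. d t * h t)"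
      using bij_betw_nth[OF \<open>distinct xs\<close>, of "{..<Suc n}" X] len setxs
      by (intro sum.reindex_bij_betw) auto
    also have "\<dots> = (\<Sum>t\<in>X. if t \<in> T then w t * h t else 0) - (\<Sum>t\<in>X. if t \<in> T' then w' t * h t else 0)"
      unfolding sum_subtractf[symmetric] by (intro sum.cong) (auto simp: d_def algebra_simps)
    also have "\<dots> = (\<Sum>t\<in>T. w t * h t) - (\<Sum>t\<in>T'. w' t * h t)"
      using X by (simp add: sum.inter_restrict[symmetric] Int_absorb1)
    finally show ?thesis .
  qed
  have "d (xs ! j) = 0" if "j < Suc n" for j
  proof (rule det_nonzero_kernel[OF _ _ that])
    have "strict_mono_on {..n} (\<lambda>i. xs ! i)"
      using len strict_sorted_list_of_set[of X]
      by (intro strict_mono_onI) (auto simp: xs_def[symmetric] sorted_wrt_iff_nth_less)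
    moreover have "xs ! j \<in> {a..b}" if "j \<le> n" for j
      using that len setxs X(2) nth_mem[of j xs] by auto
    ultimately have "Determinant.det (colloc (Suc n) u (\<lambda>j. xs ! j)) > 0"
      by (intro colloc_pos) auto
    then show "Determinant.det (Matrix.mat (Suc n) (Suc n) (\<lambda>(i, j). u i (xs ! j))) \<noteq> 0"
      by (simp add: colloc_def)
    show "(\<Sum>j<Suc n. u i (xs ! j) * d (xs ! j)) = 0" if "i < Suc n" for i
      using dsum[of "u i"] eq[of i] that by (simp add: mult.commute)
  qed
  then have "(\<Sum>j<Suc n. d (xs ! j) * g (xs ! j)) = 0" by (intro sum.neutral) simp
  with dsum[of g] show ?thesis by simp
qed

end

section \<open>A support functional at an extreme point of a vertical fibre\<close>

text \<open>
  Rewrites sums over the coordinates of \<open>curve \<gamma>\<close> as sums over the indices of \<open>\<gamma>\<close>.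
\<close>

lemma bij_betw_card_atMost:
  "bij_betw (\<lambda>i::'n::{finite,linorder}. card {..i}) UNIV {1..CARD('n)}"
proof -
  have "inj (\<lambda>i::'n. card {..i})"
  proof (rule injI)
    fix i j :: 'n assume eq: "card {..i} = card {..j}"
    have "card {..p} < card {..q}" if "p < q" for p q :: 'n
      using that by (intro psubset_card_mono) (auto simp: psubset_eq)
    with eq show "i = j" by (metis less_irrefl neqE)
  qed
  moreover have "(\<lambda>i::'n. card {..i}) ` UNIV \<subseteq> {1..CARD('n)}"
    by (auto intro!: card_mono simp: Suc_le_eq card_gt_0_iff)
  ultimately show ?thesis
    by (simp add: bij_betw_def card_image card_subset_eq)
qed

lemma convex_hull_image_finite:
  fixes f :: "'a \<Rightarrow> 'b::real_vector"
  assumes "p \<in> convex hull (f ` A)"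
  obtains T w where "finite T" "T \<subseteq> A" "\<forall>t\<in>T. w t > 0" "sum w T = (1::real)"
    "p = (\<Sum>t\<in>T. w t *\<^sub>R f t)"
proof -
  obtain S c where S: "finite S" "S \<subseteq> f ` A" "\<And>q. q \<in> S \<Longrightarrow> 0 \<le> c q" "sum c S = 1"
    and p: "(\<Sum>q\<in>S. c q *\<^sub>R q) = p"
    using assms unfolding convex_hull_explicit by blast
  define g where "g = inv_into A f"
  have fg: "f (g q) = q" if "q \<in> S" for q
    using S(2) that unfolding g_def by (meson f_inv_into_f subsetD)
  define S' where "S' = {q \<in> S. c q > 0}"
  have inj: "inj_on g S'" by (intro inj_on_inverseI[of _ f]) (use fg in \<open>auto simp: S'_def\<close>)
  define w where "w t = c (f t)" for t
  have sub: "S' \<subseteq> S" and fin: "finite S'" using S(1) by (auto simp: S'_def)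
  have 0: "c q = 0" if "q \<in> S - S'" for q using that S(3)[of q] by (auto simp: S'_def)
  show ?thesis
  proof (rule that[of "g ` S'" w])
    show "g ` S' \<subseteq> A" using S(2) sub unfolding g_def by (auto intro: inv_into_into)
    show "\<forall>t\<in>g ` S'. w t > 0" using fg by (auto simp: w_def S'_def)
    have "sum w (g ` S') = sum c S'"
      using inj fg sub by (subst sum.reindex) (auto simp: w_def intro!: sum.cong)
    also have "\<dots> = sum c S" using S(1) sub 0 by (intro sum.mono_neutral_left) auto
    finally show "sum w (g ` S') = 1" using S by simp
    have "(\<Sum>t\<in>g ` S'. w t *\<^sub>R f t) = (\<Sum>q\<in>S'. c q *\<^sub>R q)"
      using inj fg sub by (subst sum.reindex) (auto simp: w_def intro!: sum.cong)
    also have "\<dots> = (\<Sum>q\<in>S. c q *\<^sub>R q)" using S(1) sub 0 by (intro sum.mono_neutral_left) auto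
    finally show "p = (\<Sum>t\<in>g ` S'. w t *\<^sub>R f t)" using p by simp
  qed (use fin in simp)
qed

text \<open>
  The type argument fixes the dimension of the space that contains the curve \<open>\<gamma>\<^sub>1, \<dots>, \<gamma>\<^sub>n\<close>.
\<close>

locale moment_curve =
  fixes \<gamma> :: "nat \<Rightarrow> real \<Rightarrow> real" and a b :: real and dim :: "'n::{finite,linorder} itself"
  assumes cont: "\<And>i. i \<in> {1..CARD('n) + 1} \<Longrightarrow> continuous_on {a..b} (\<gamma> i)"
    and chebyshev: "chebyshev_pair (with_one \<gamma>) CARD('n) a b"
begin

sublocale chebyshev_pair "with_one \<gamma>" "CARD('n)" a b
  by (rule chebyshev)

definition full_curve :: "real \<Rightarrow> (real ^ ('n::{finite,linorder})) \<times> real" where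
  "full_curve t = (curve \<gamma> t, \<gamma> (CARD('n) + 1) t)"

definition moment_space :: "((real ^ ('n::{finite,linorder})) \<times> real) set" where
  "moment_space = convex hull (full_curve ` {a..b})"

lemma continuous_coordinate: "continuous_on {a..b} (\<gamma> (card {..i :: 'n::{finite,linorder}}))"
  using bij_betwE[OF bij_betw_card_atMost[where 'n='n]]
  by (intro cont) (metis UNIV_I atLeastAtMost_iff trans_le_add1)

lemma continuous_full_curve: "continuous_on {a..b} full_curve"
  unfolding full_curve_def curve_def
  by (intro continuous_on_Pair continuous_on_vec_lambda continuous_coordinate cont) simp

lemma compact_moment_space: "compact moment_space"
  unfolding moment_space_def
  by (intro compact_convex_hull compact_continuous_image continuous_full_curve) simp

lemma convex_moment_space: "convex moment_space"
  by (simp add: moment_space_def)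

lemma full_curve_in_moment_space: "t \<in> {a..b} \<Longrightarrow> full_curve t \<in> moment_space"
  by (simp add: moment_space_def hull_inc)

text \<open>
  Turns a hyperplane into a combination of \<open>1, \<gamma>\<^sub>1, \<dots>, \<gamma>\<^sub>n\<^sub>+\<^sub>1\<close>, to which the count of zeros applies.
\<close>

lemma affine_functional_coefficients:
  fixes c :: "(real ^ ('n::{finite,linorder})) \<times> real"
  assumes "c \<noteq> 0"
  obtains q i where "\<forall>t. \<beta> - inner c (full_curve t) = (\<Sum>i\<le>CARD('n)+1. q i * with_one \<gamma> i t)"
    "q (CARD('n) + 1) = - snd c" "i \<le> CARD('n) + 1" "q i \<noteq> 0"
proof -
  let ?n = "CARD('n)"
  let ?k = "\<lambda>i::'n. card {..i}"
  define idx where "idx = inv_into UNIV ?k"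
  note bij = bij_betw_card_atMost[where 'n='n]
  have idx: "idx (?k i) = i" for i
    unfolding idx_def using bij_betw_imp_inj_on[OF bij] by (rule inv_into_f_f) simp
  define q where "q i = (if i = 0 then \<beta> else if i = ?n + 1 then - snd c else - vec_nth (fst c) (idx i))" for i
  have "\<beta> - inner c (full_curve t) = (\<Sum>i\<le>?n+1. q i * with_one \<gamma> i t)" for t
  proof -
    have "inner (fst c) (curve \<gamma> t) = (\<Sum>i\<in>UNIV. vec_nth (fst c) i * \<gamma> (?k i) t)"
      by (simp add: inner_vec_def curve_def)
    also have "\<dots> = (\<Sum>i\<in>UNIV. (\<lambda>m. vec_nth (fst c) (idx m) * \<gamma> m t) (?k i))"
      by (simp add: idx)
    also have "\<dots> = (\<Sum>m\<in>{1..?n}. vec_nth (fst c) (idx m) * \<gamma> m t)"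
      using bij by (rule sum.reindex_bij_betw)
    also have "\<dots> = - (\<Sum>i\<in>{1..?n}. q i * with_one \<gamma> i t)"
      unfolding sum_negf[symmetric] by (intro sum.cong) (auto simp: q_def with_one_def)
    finally have "inner c (full_curve t) = - (\<Sum>i\<in>{1..?n}. q i * with_one \<gamma> i t) + snd c * \<gamma> (?n + 1) t"
      by (cases c) (simp add: full_curve_def)
    moreover have "{..?n+1} = insert 0 (insert (?n + 1) {1..?n})" by auto
    ultimately show ?thesis by (simp add: q_def with_one_def)
  qed
  moreover have "q (?n + 1) = - snd c" by (simp add: q_def)
  moreover have "\<exists>i\<le>?n+1. q i \<noteq> 0"
  proof (cases "snd c = 0")
    case True
    then have "fst c \<noteq> 0" using assms by (simp add: prod_eq_iff)
    then obtain j where j: "vec_nth (fst c) j \<noteq> 0" by (auto simp: Finite_Cartesian_Product.vec_eq_iff)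
    have "?k j \<in> {1..?n}" using bij by (auto simp: bij_betw_def)
    then have "q (?k j) \<noteq> 0" "?k j \<le> ?n + 1" using j idx[of j] by (auto simp: q_def)
    then show ?thesis by blast
  qed (auto simp: q_def)
  ultimately show ?thesis using that by blast
qed

text \<open>
  Among the points of the compact convex moment space above \<open>x\<close> take one, \<open>(x, V)\<close>, at which
  \<open>s * v\<close> is maximal, where \<open>s = (-1) ^ (n + e)\<close>. A hyperplane separates the moment space from the open
  vertical ray beyond \<open>(x, V)\<close>. The affine functional \<open>Q\<close> that it defines is nonnegative along the curve,
  its coefficient at \<open>\<gamma>\<^sub>n\<^sub>+\<^sub>1\<close> has the sign needed for the count of zeros, and it vanishes at every atom of
  every representation of \<open>(x, V)\<close>. Hence there are few atoms. A vertical hyperplane, which can occur if \<open>x\<close>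
  is on the boundary of the convex hull, has coefficient zero and is covered by the weak inequality.
\<close>

lemma extremal_representation:
  fixes x :: "real ^ ('n::{finite,linorder})"
  assumes e: "e \<le> 1" and x: "x \<in> convex hull (curve \<gamma> ` {a..b})"
  obtains T w where "finite T" "T \<subseteq> {a..b}" "\<forall>t\<in>T. w t > 0" "sum w T = 1"
    "x = (\<Sum>t\<in>T. w t *\<^sub>R curve \<gamma> t)" "card (T - endpoints e) \<le> free_points e"
    "\<forall>v. (x, v) \<in> moment_space \<longrightarrow>
       (-1) ^ (CARD('n) + e) * v \<le> (-1) ^ (CARD('n) + e) * (\<Sum>t\<in>T. w t * \<gamma> (CARD('n) + 1) t)"
proof -
  let ?n = "CARD('n)"
  define s :: real where "s = (-1) ^ (?n + e)"
  have ss: "s * s = 1" by (simp add: s_def power_mult_distrib[symmetric])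
  have "fst ` moment_space = convex hull (curve \<gamma> ` {a..b})"
    unfolding moment_space_def convex_hull_linear_image[OF linear_fst] image_image
    by (simp add: full_curve_def)
  then obtain v0 where v0: "(x, v0) \<in> moment_space" using x by (metis imageE prod.collapse)
  define A where "A = moment_space \<inter> (fst -` {x})"
  have "compact A"
    unfolding A_def
    by (intro compact_Int_closed compact_moment_space closed_vimage continuous_on_fst) (auto intro: continuous_intros)
  moreover have "A \<noteq> {}" using v0 by (auto simp: A_def)
  ultimately obtain p where p: "p \<in> A" "\<And>q. q \<in> A \<Longrightarrow> s * snd q \<le> s * snd p"
    using continuous_attains_sup[of A "\<lambda>q. s * snd q"] continuous_on_mult_left[OF continuous_on_snd[OF continuous_on_id]]
    by metis
  define V where "V = snd p"
  have V: "(x, V) \<in> moment_space" and Vmax: "\<And>v. (x, v) \<in> moment_space \<Longrightarrow> s * v \<le> s * V"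
    using p by (auto simp: A_def V_def)
  \<comment> \<open>the ray beyond \<open>(x, V)\<close> in the direction \<open>s\<close>\<close>
  define R where "R = {(x, V + s * r) | r. r > 0}"
  have "convex R"
  proof (rule convexI)
    fix p q and \<theta> \<mu> :: real
    assume "p \<in> R" "q \<in> R" and lm: "0 \<le> \<theta>" "0 \<le> \<mu>" "\<theta> + \<mu> = 1"
    then obtain r r' where r: "p = (x, V + s * r)" "q = (x, V + s * r')" "r > 0" "r' > 0"
      by (auto simp: R_def)
    have \<mu>: "\<mu> = 1 - \<theta>" using lm by simp
    have "\<theta> *\<^sub>R p + \<mu> *\<^sub>R q = (x, V + s * (\<theta> * r + \<mu> * r'))"
      unfolding r \<mu> by (simp add: algebra_simps)
    moreover have "\<theta> * r + \<mu> * r' > 0"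
      using convex_bound_lt[of "- r" 0 "- r'" \<theta> \<mu>] r lm by simp
    ultimately show "\<theta> *\<^sub>R p + \<mu> *\<^sub>R q \<in> R" by (auto simp: R_def)
  qed
  moreover have "moment_space \<inter> R = {}"
  proof -
    have False if "r > 0" "(x, V + s * r) \<in> moment_space" for r
      using Vmax[OF that(2)] that(1) ss by (simp add: distrib_left mult.assoc[symmetric])
    then show ?thesis by (auto simp: R_def)
  qed
  moreover have "(x, V + s * 1) \<in> R" unfolding R_def by (intro CollectI exI[of _ 1]) simp
  ultimately obtain c \<beta> where c: "c \<noteq> 0" and below: "\<And>q. q \<in> moment_space \<Longrightarrow> inner c q \<le> \<beta>"
    and above: "\<And>q. q \<in> R \<Longrightarrow> inner c q \<ge> \<beta>"
    using separating_hyperplane_sets[OF convex_moment_space, of R] V by (metis empty_iff)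
  have ray: "inner c (x, V) + snd c * s * r \<ge> \<beta>" if "r > 0" for r
    using above[of "(x, V + s * r)"] that by (cases c) (auto simp: R_def algebra_simps)
  have on: "inner c (x, V) \<le> \<beta>" by (rule below[OF V])
  have cs: "snd c * s \<ge> 0"
    using ray[of 1] on by simp
  \<comment> \<open>the separating hyperplane passes through the initial point of the ray\<close>
  have eq: "inner c (x, V) = \<beta>"
  proof (rule antisym[OF on], rule field_le_epsilon)
    fix d :: real assume "d > 0"
    define m where "m = snd c * s"
    have "m \<ge> 0" using cs by (simp add: m_def)
    have "m * d \<le> d * (m + 1)" using \<open>d > 0\<close> by (simp add: distrib_left mult.commute)
    then have "m * (d / (m + 1)) \<le> d"
      using pos_divide_le_eq[of "m + 1" "m * d" d] \<open>m \<ge> 0\<close> by simp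
    then have "snd c * s * (d / (snd c * s + 1)) \<le> d" by (simp only: m_def)
    then show "\<beta> \<le> inner c (x, V) + d"
      using ray[of "d / (snd c * s + 1)"] \<open>d > 0\<close> cs by simp
  qed
  obtain T w where T: "finite T" "T \<subseteq> {a..b}" "\<forall>t\<in>T. w t > 0" "sum w T = 1"
    and xV: "(x, V) = (\<Sum>t\<in>T. w t *\<^sub>R full_curve t)"
    using V unfolding moment_space_def by (rule convex_hull_image_finite) (rule that)
  obtain q i where q: "\<forall>t. \<beta> - inner c (full_curve t) = (\<Sum>i\<le>?n+1. q i * with_one \<gamma> i t)"
    and qn: "q (?n + 1) = - snd c" and i: "i \<le> ?n + 1" "q i \<noteq> 0"
    by (rule affine_functional_coefficients[OF c, of \<beta>]) (rule that)
  have nonneg: "\<beta> - inner c (full_curve t) \<ge> 0" if "t \<in> {a..b}" for t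
    using below[OF full_curve_in_moment_space[OF that]] by simp
  have nn: "0 \<le> w t * (\<beta> - inner c (full_curve t))" if "t \<in> T" for t
    using that T(2,3) nonneg[of t] by (intro mult_nonneg_nonneg) (auto intro: less_imp_le)
  \<comment> \<open>the functional has mean zero under the representing measure and is nonnegative\<close>
  have "(\<Sum>t\<in>T. w t * (\<beta> - inner c (full_curve t))) = \<beta> * sum w T - inner c (x, V)"
    unfolding xV by (simp add: inner_sum_right right_diff_distrib sum_subtractf sum_distrib_left mult.commute)
  also have "\<dots> = 0" using T(4) eq by simp
  finally have "\<forall>t\<in>T. w t * (\<beta> - inner c (full_curve t)) = 0"
    using nn by (subst (asm) sum_nonneg_eq_0_iff[OF T(1)])
  then have zero: "\<beta> - inner c (full_curve t) = 0" if "t \<in> T" for t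
    using that T(3) by fastforce
  have "card (T - endpoints e) \<le> free_points e"
  proof (rule card_zeros_le[where c = q, OF e _ _ i T(2)])
    show "(-1) ^ (?n + e) * q (?n + 1) \<le> 0"
      using cs unfolding qn by (simp add: s_def mult.commute)
  qed (use nonneg zero q in auto)
  moreover have "x = (\<Sum>t\<in>T. w t *\<^sub>R curve \<gamma> t)"
    using arg_cong[OF xV, of fst] by (simp add: fst_sum full_curve_def)
  moreover have "V = (\<Sum>t\<in>T. w t * \<gamma> (?n + 1) t)"
    using arg_cong[OF xV, of snd] by (simp add: snd_sum full_curve_def)
  ultimately show ?thesis using that[of T w] T Vmax unfolding s_def by blast
qed

end

section \<open>Lists of atoms of principal form\<close>

lemma weighted_sum_simps [simp]:
  "weighted_sum F [] = 0"
  "weighted_sum F ((t, w) # ps) = w *\<^sub>R F t + weighted_sum F ps"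
  "weighted_sum F (ps @ qs) = weighted_sum F ps + weighted_sum F qs"
  "weighted_sum F (map (\<lambda>j. (y j, \<beta> j)) [i..<k]) = (\<Sum>j\<in>{i..<k}. \<beta> j *\<^sub>R F (y j))"
  by (simp_all add: weighted_sum_def o_def sum_list_distinct_conv_sum_set)

definition atom_weight :: "(real \<times> real) list \<Rightarrow> real \<Rightarrow> real" where
  "atom_weight ps t = sum_list (map snd (filter (\<lambda>z. fst z = t) ps))"

lemma weighted_sum_eq_sum:
  assumes "finite A" "fst ` set ps \<subseteq> A"
  shows "weighted_sum F ps = (\<Sum>t\<in>A. atom_weight ps t *\<^sub>R F t)"
  using assms(2)
proof (induction ps)
  case Nil
  then show ?case by (simp add: atom_weight_def)
next
  case (Cons p ps)
  obtain s w where p: "p = (s, w)" by (cases p)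
  have "(\<Sum>t\<in>A. atom_weight (p # ps) t *\<^sub>R F t)
      = (\<Sum>t\<in>A. (if t = s then w *\<^sub>R F s else 0) + atom_weight ps t *\<^sub>R F t)"
    by (intro sum.cong) (auto simp: atom_weight_def p algebra_simps)
  also have "\<dots> = w *\<^sub>R F s + weighted_sum F ps"
    using Cons assms(1) by (simp add: sum.distrib p)
  finally show ?case by (simp add: p)
qed

text \<open>
  The parameter sets have a fixed number of coordinates. Missing points are supplied by copies of \<open>b\<close>
  without weight, placed last to keep the enumeration increasing.
\<close>

lemma enumerate_padded:
  fixes F :: "real \<Rightarrow> 'v::real_vector"
  assumes T: "finite T" "T \<subseteq> {a..b}" "card T \<le> m" and w: "\<And>t. t \<in> T \<Longrightarrow> 0 \<le> w t" and ab: "a \<le> b"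
  obtains y \<beta> where "y \<in> Delta_ord a b {p..<p+m}" "\<forall>j. 0 \<le> \<beta> j"
    "(\<Sum>j\<in>{p..<p+m}. \<beta> j *\<^sub>R F (y j)) = (\<Sum>t\<in>T. w t *\<^sub>R F t)"
proof -
  define xs where "xs = sorted_list_of_set T"
  have len: "length xs = card T" and setxs: "set xs = T" and dist: "distinct xs" and "sorted xs"
    using T by (auto simp: xs_def)
  define y where "y j = (if j - p < length xs then xs ! (j - p) else b)" for j
  define \<beta> where "\<beta> j = (if j - p < length xs then w (xs ! (j - p)) else 0)" for j
  have xsT: "xs ! i \<in> T" if "i < length xs" for i using that setxs nth_mem by blast
  have yab: "y j \<in> {a..b}" for j using xsT[of "j - p"] T(2) ab by (auto simp: y_def)
  have "mono_on {p..<p+m} y"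
  proof (rule mono_onI)
    fix i j assume "i \<in> {p..<p+m}" "j \<in> {p..<p+m}" "i \<le> j"
    then show "y i \<le> y j"
      using yab[of i] \<open>sorted xs\<close> by (auto simp: y_def intro: sorted_nth_mono)
  qed
  then have 1: "y \<in> Delta_ord a b {p..<p+m}" using yab by (auto simp: Delta_ord_def)
  have 2: "\<forall>j. 0 \<le> \<beta> j" using w xsT by (auto simp: \<beta>_def)
  have "(\<Sum>j\<in>{p..<p+m}. \<beta> j *\<^sub>R F (y j)) = (\<Sum>i\<in>{0..<m}. \<beta> (i + p) *\<^sub>R F (y (i + p)))"
    using sum.shift_bounds_nat_ivl[of "\<lambda>j. \<beta> j *\<^sub>R F (y j)" 0 p m] by (simp add: add.commute)
  also have "\<dots> = (\<Sum>i\<in>{..<length xs}. w (xs ! i) *\<^sub>R F (xs ! i))"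
    using T(3) len by (intro sum.mono_neutral_cong_right) (auto simp: y_def \<beta>_def)
  also have "\<dots> = (\<Sum>t\<in>T. w t *\<^sub>R F t)"
    using bij_betw_nth[OF dist, of "{..<length xs}" T] setxs
    by (intro sum.reindex_bij_betw) auto
  finally show ?thesis using that 1 2 by blast
qed

lemma card_image_atoms_le:
  assumes "X \<subseteq> y ` {i..<k}"
  shows "card X \<le> k - i"
  using assms by (metis card_atLeastLessThan card_image_le card_mono finite_atLeastLessThan finite_imageI le_trans)

context chebyshev_pair
begin

text \<open>
  The form of the extremal measures, for arbitrary lists of atoms: coinciding points and atoms of
  weight zero are allowed, and the bound concerns the set of listed points.
\<close>

definition principal :: "nat \<Rightarrow> (real \<times> real) list \<Rightarrow> bool" where
  "principal e ps \<longleftrightarrow> pmf_of_list_wf ps \<and> fst ` set ps \<subseteq> {a..b} \<and>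
     card (fst ` set ps - endpoints e) \<le> free_points e"

lemma principal_sup_atoms:
  assumes "(\<beta>, y) \<in> sup_params n a b"
  shows "principal (n mod 2) (sup_atoms n a b \<beta> y)"
proof -
  define l where "l = (n + 1) div 2"
  show ?thesis
  proof (cases "even n")
    case True
    have e: "n mod 2 = 0" "endpoints 0 = {b}" "free_points 0 = l"
      using True by (auto simp: endpoints_def free_points_def l_def)
    have at: "sup_atoms n a b \<beta> y = map (\<lambda>j. (y j, \<beta> j)) [1..<l + 1] @ [(b, 1 - (\<Sum>j=1..l. \<beta> j))]"
      using True by (simp add: sup_atoms_def l_def Let_def)
    have p: "\<And>j. j \<in> {1..l} \<Longrightarrow> 0 \<le> \<beta> j" "(\<Sum>j=1..l. \<beta> j) \<le> 1" "\<And>j. j \<in> {1..l} \<Longrightarrow> y j \<in> {a..b}"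
      using assms True by (auto simp: sup_params_def l_def Let_def Delta_c_def Delta_ord_def)
    have "card (fst ` set (sup_atoms n a b \<beta> y) - {b}) \<le> l + 1 - 1"
      unfolding at by (intro card_image_atoms_le[where y = y]) auto
    moreover have "pmf_of_list_wf (sup_atoms n a b \<beta> y)"
      unfolding at using p
      by (intro pmf_of_list_wfI) (auto simp: o_def sum_list_distinct_conv_sum_set atLeastLessThanSuc_atLeastAtMost simp del: upt_Suc)
    moreover have "fst ` set (sup_atoms n a b \<beta> y) \<subseteq> {a..b}"
      unfolding at using p(3) ab by auto
    ultimately show ?thesis unfolding principal_def e by simp
  next
    case False
    have e: "n mod 2 = 1" "endpoints 1 = {a, b}" "free_points 1 = l - 1"
      using False by (auto simp: endpoints_def free_points_def l_def odd_iff_mod_2_eq_one elim!: oddE)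
    have l: "{1..l} = insert 1 {2..l}" using False by (auto simp: l_def elim!: oddE)
    have at: "sup_atoms n a b \<beta> y
        = (a, 1 - (\<Sum>j=1..l. \<beta> j)) # map (\<lambda>j. (y j, \<beta> j)) [2..<l + 1] @ [(b, \<beta> 1)]"
      using False by (simp add: sup_atoms_def l_def Let_def)
    have p: "\<And>j. j \<in> {1..l} \<Longrightarrow> 0 \<le> \<beta> j" "(\<Sum>j=1..l. \<beta> j) \<le> 1" "\<And>j. j \<in> {2..l} \<Longrightarrow> y j \<in> {a..b}"
      using assms False by (auto simp: sup_params_def l_def Let_def Delta_c_def Delta_ord_def)
    have "1 \<le> l" using False by (auto simp: l_def elim!: oddE)
    then have "0 \<le> \<beta> 1" by (intro p(1)) simp
    have sum1: "(\<Sum>j=1..l. \<beta> j) = \<beta> 1 + (\<Sum>j=2..l. \<beta> j)" unfolding l by simp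
    have "card (fst ` set (sup_atoms n a b \<beta> y) - {a, b}) \<le> l + 1 - 2"
      unfolding at by (intro card_image_atoms_le[where y = y]) auto
    moreover have "pmf_of_list_wf (sup_atoms n a b \<beta> y)"
      unfolding at using p \<open>0 \<le> \<beta> 1\<close> unfolding sum1
      by (intro pmf_of_list_wfI)
        (auto simp: o_def sum_list_distinct_conv_sum_set atLeastLessThanSuc_atLeastAtMost simp del: upt_Suc)
    moreover have "fst ` set (sup_atoms n a b \<beta> y) \<subseteq> {a..b}"
      unfolding at using p(3) ab by auto
    ultimately show ?thesis unfolding principal_def e by simp
  qed
qed

lemma principal_inf_atoms:
  assumes "(\<beta>, y) \<in> inf_params n a b"
  shows "principal (1 - n mod 2) (inf_atoms n a b \<beta> y)"
proof -
  define l where "l = (n + 1) div 2"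
  show ?thesis
  proof (cases "even n")
    case True
    have e: "1 - n mod 2 = 1" "endpoints 1 = {a}" "free_points 1 = l"
      using True by (auto simp: endpoints_def free_points_def l_def)
    have at: "inf_atoms n a b \<beta> y = (a, 1 - (\<Sum>j=1..l. \<beta> j)) # map (\<lambda>j. (y j, \<beta> j)) [1..<l + 1]"
      using True by (simp add: inf_atoms_def l_def Let_def)
    have p: "\<And>j. j \<in> {1..l} \<Longrightarrow> 0 \<le> \<beta> j" "(\<Sum>j=1..l. \<beta> j) \<le> 1" "\<And>j. j \<in> {1..l} \<Longrightarrow> y j \<in> {a..b}"
      using assms True by (auto simp: inf_params_def l_def Let_def Delta_c_def Delta_ord_def)
    have "card (fst ` set (inf_atoms n a b \<beta> y) - {a}) \<le> l + 1 - 1"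
      unfolding at by (intro card_image_atoms_le[where y = y]) auto
    moreover have "pmf_of_list_wf (inf_atoms n a b \<beta> y)"
      unfolding at using p
      by (intro pmf_of_list_wfI) (auto simp: o_def sum_list_distinct_conv_sum_set atLeastLessThanSuc_atLeastAtMost simp del: upt_Suc)
    moreover have "fst ` set (inf_atoms n a b \<beta> y) \<subseteq> {a..b}"
      unfolding at using p(3) ab by auto
    ultimately show ?thesis unfolding principal_def e by simp
  next
    case False
    have e: "1 - n mod 2 = 0" "endpoints 0 = {}" "free_points 0 = l"
      using False by (auto simp: endpoints_def free_points_def l_def odd_iff_mod_2_eq_one)
    have l1: "1 \<le> l" using False by (auto simp: l_def elim!: oddE)
    have at: "inf_atoms n a b \<beta> y
        = (y 1, 1 - (\<Sum>j=2..l. \<beta> j)) # map (\<lambda>j. (y j, \<beta> j)) [2..<l + 1]"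
      using False by (simp add: inf_atoms_def l_def Let_def)
    have p: "\<And>j. j \<in> {2..l} \<Longrightarrow> 0 \<le> \<beta> j" "(\<Sum>j=2..l. \<beta> j) \<le> 1" "\<And>j. j \<in> {1..l} \<Longrightarrow> y j \<in> {a..b}"
      using assms False by (auto simp: inf_params_def l_def Let_def Delta_c_def Delta_ord_def)
    have "card (fst ` set (inf_atoms n a b \<beta> y)) \<le> l + 1 - 1"
      unfolding at using l1 by (intro card_image_atoms_le[where y = y]) auto
    moreover have "pmf_of_list_wf (inf_atoms n a b \<beta> y)"
      unfolding at using p
      by (intro pmf_of_list_wfI) (auto simp: o_def sum_list_distinct_conv_sum_set atLeastLessThanSuc_atLeastAtMost simp del: upt_Suc)
    moreover have "fst ` set (inf_atoms n a b \<beta> y) \<subseteq> {a..b}"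
      unfolding at using p(3) l1 by auto
    ultimately show ?thesis unfolding principal_def e by simp
  qed
qed

text \<open>
  Splits a measure into its part on \<open>endpoints e\<close>, with weights \<open>\<omega>\<close>, and an enumeration of the free points.
  Integrating \<open>(1, F)\<close> at once gives one set of parameters that is right both for the total mass and for \<open>F\<close>.
\<close>

lemma enumerate_principal:
  fixes F :: "real \<Rightarrow> 'v::real_vector"
  assumes T: "finite T" "T \<subseteq> {a..b}" "card (T - endpoints e) \<le> m"
    and w: "\<And>t. t \<in> T \<Longrightarrow> w t > 0" "sum w T = 1"
  obtains y \<beta> \<omega> where "y \<in> Delta_ord a b {p..<p+m}" "\<forall>j. 0 \<le> \<beta> j" "\<forall>t. 0 \<le> \<omega> t"
    "(\<Sum>j\<in>{p..<p+m}. \<beta> j) + sum \<omega> (endpoints e) = (1::real)"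
    "(\<Sum>t\<in>T. w t *\<^sub>R F t)
       = (\<Sum>j\<in>{p..<p+m}. \<beta> j *\<^sub>R F (y j)) + (\<Sum>t\<in>endpoints e. \<omega> t *\<^sub>R F t)"
proof -
  define G where "G t = (1::real, F t)" for t
  obtain y \<beta> where y: "y \<in> Delta_ord a b {p..<p+m}" "\<forall>j. 0 \<le> \<beta> j"
    and G: "(\<Sum>j\<in>{p..<p+m}. \<beta> j *\<^sub>R G (y j)) = (\<Sum>t\<in>T - endpoints e. w t *\<^sub>R G t)"
  proof (rule enumerate_padded[where T = "T - endpoints e" and a = a and b = b and m = m and w = w and F = G and p = p])
    show "0 \<le> w t" if "t \<in> T - endpoints e" for t using w(1)[of t] that by simp
  qed (use T ab in auto)
  define \<omega> where "\<omega> t = (if t \<in> T then w t else 0)" for t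
  have fin: "finite (endpoints e)" by (simp add: endpoints_def)
  have "(\<Sum>t\<in>T. w t *\<^sub>R G t) = (\<Sum>t\<in>T - endpoints e. w t *\<^sub>R G t) + (\<Sum>t\<in>T \<inter> endpoints e. w t *\<^sub>R G t)"
    by (subst sum.Int_Diff[OF T(1), of _ "endpoints e"]) (simp add: add.commute)
  also have "(\<Sum>t\<in>T \<inter> endpoints e. w t *\<^sub>R G t) = (\<Sum>t\<in>endpoints e. \<omega> t *\<^sub>R G t)"
    using fin by (intro sum.mono_neutral_cong_left) (auto simp: \<omega>_def)
  finally have sumG: "(\<Sum>t\<in>T. w t *\<^sub>R G t)
      = (\<Sum>j\<in>{p..<p+m}. \<beta> j *\<^sub>R G (y j)) + (\<Sum>t\<in>endpoints e. \<omega> t *\<^sub>R G t)"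
    by (simp add: G)
  show ?thesis
  proof (rule that[of y \<beta> \<omega>])
    show "(\<Sum>j\<in>{p..<p+m}. \<beta> j) + sum \<omega> (endpoints e) = 1"
      using arg_cong[OF sumG, of fst] w(2) by (simp add: fst_sum G_def)
    show "(\<Sum>t\<in>T. w t *\<^sub>R F t)
       = (\<Sum>j\<in>{p..<p+m}. \<beta> j *\<^sub>R F (y j)) + (\<Sum>t\<in>endpoints e. \<omega> t *\<^sub>R F t)"
      using arg_cong[OF sumG, of snd] by (simp add: snd_sum G_def)
    show "\<forall>t. 0 \<le> \<omega> t" using w(1) by (auto simp: \<omega>_def less_imp_le)
  qed (use y in auto)
qed

text \<open>
  The enumeration of the free points gives the parameters. The weight that is one minus the sum of the
  others goes to \<open>b\<close> for even \<open>n\<close> and to \<open>a\<close> for odd \<open>n\<close>; for odd \<open>n\<close> the coordinate \<open>1\<close> of the weights belongs to the atom \<open>b\<close>.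
\<close>

lemma sup_atoms_exist:
  fixes F :: "real \<Rightarrow> 'v::real_vector"
  assumes T: "finite T" "T \<subseteq> {a..b}" "card (T - endpoints (n mod 2)) \<le> free_points (n mod 2)"
    and w: "\<And>t. t \<in> T \<Longrightarrow> w t > 0" "sum w T = 1"
  shows "\<exists>(\<beta>, y) \<in> sup_params n a b. weighted_sum F (sup_atoms n a b \<beta> y) = (\<Sum>t\<in>T. w t *\<^sub>R F t)"
proof -
  define l where "l = (n + 1) div 2"
  show ?thesis
  proof (cases "even n")
    case True
    have e: "n mod 2 = 0" "endpoints 0 = {b}" "free_points 0 = l"
      using True by (auto simp: endpoints_def free_points_def l_def)
    obtain y \<beta> \<omega> where y: "y \<in> Delta_ord a b {1..<1+l}" "\<forall>j. 0 \<le> \<beta> j" "\<forall>t. 0 \<le> \<omega> t"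
      and s: "(\<Sum>j\<in>{1..<1+l}. \<beta> j) + sum \<omega> (endpoints 0) = (1::real)"
      and F: "(\<Sum>t\<in>T. w t *\<^sub>R F t)
       = (\<Sum>j\<in>{1..<1+l}. \<beta> j *\<^sub>R F (y j)) + (\<Sum>t\<in>endpoints 0. \<omega> t *\<^sub>R F t)"
      by (rule enumerate_principal[OF T(1,2), of 0 l w 1 F]) (use T(3) w e in auto)
    have iv: "{1..<1+l} = {1..l}" by auto
    have s': "(\<Sum>j\<in>{1..l}. \<beta> j) + \<omega> b = 1" using s unfolding iv e by simp
    have sup_at: "sup_atoms n a b \<beta> y = map (\<lambda>j. (y j, \<beta> j)) [1..<l + 1] @ [(b, 1 - (\<Sum>j=1..l. \<beta> j))]" for \<beta> y
      using True by (simp add: sup_atoms_def l_def Let_def)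
    have "sup_params n a b = Delta_c {1..l} \<times> Delta_ord a b {1..l}"
      using True by (simp add: sup_params_def Let_def l_def)
    then have "(\<beta>, y) \<in> sup_params n a b"
      using y(1,2) s' y(3)[rule_format, of b] unfolding iv by (simp add: Delta_c_def)
    moreover have "weighted_sum F (sup_atoms n a b \<beta> y) = (\<Sum>t\<in>T. w t *\<^sub>R F t)"
    proof -
      have "1 - (\<Sum>j\<in>{1..l}. \<beta> j) = \<omega> b" using s' by simp
      then show ?thesis
        unfolding F e using True
        by (simp add: sup_at e iv atLeastLessThanSuc_atLeastAtMost del: upt_Suc)
    qed
    ultimately show ?thesis by blast
  next
    case False
    have e: "n mod 2 = 1" "endpoints 1 = {a, b}" "free_points 1 = l - 1"
      using False by (auto simp: endpoints_def free_points_def l_def odd_iff_mod_2_eq_one elim!: oddE)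
    have l: "1 \<le> l" using False by (auto simp: l_def elim!: oddE)
    obtain y \<beta> \<omega> where y: "y \<in> Delta_ord a b {2..<2+(l-1)}" "\<forall>j. 0 \<le> \<beta> j" "\<forall>t. 0 \<le> \<omega> t"
      and s: "(\<Sum>j\<in>{2..<2+(l-1)}. \<beta> j) + sum \<omega> (endpoints 1) = (1::real)"
      and F: "(\<Sum>t\<in>T. w t *\<^sub>R F t)
       = (\<Sum>j\<in>{2..<2+(l-1)}. \<beta> j *\<^sub>R F (y j)) + (\<Sum>t\<in>endpoints 1. \<omega> t *\<^sub>R F t)"
      by (rule enumerate_principal[OF T(1,2), of 1 "l - 1" w 2 F]) (use T(3) w e in auto)
    have iv: "{2..<2+(l-1)} = {2..l}" "{1..l} = insert 1 {2..l}" using l by auto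
    \<comment> \<open>coordinate \<open>1\<close>, outside the range of the enumeration, holds the weight at \<open>b\<close>\<close>
    define \<beta>' where "\<beta>' = \<beta>(1 := \<omega> b)"
    have \<beta>': "(\<Sum>j\<in>{2..l}. \<beta>' j) = (\<Sum>j\<in>{2..l}. \<beta> j)"
      by (intro sum.cong) (auto simp: \<beta>'_def)
    have b1: "\<beta>' (Suc 0) = \<omega> b" by (simp add: \<beta>'_def)
    have s': "(\<Sum>j\<in>{1..l}. \<beta>' j) + \<omega> a = 1"
      using s ab \<beta>' unfolding iv e by (simp add: b1)
    have sup_at: "sup_atoms n a b \<beta> y = (a, 1 - (\<Sum>j=1..l. \<beta> j)) # map (\<lambda>j. (y j, \<beta> j)) [2..<l + 1] @ [(b, \<beta> 1)]" for \<beta> y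
      using False by (simp add: sup_atoms_def l_def Let_def)
    have "sup_params n a b = Delta_c {1..l} \<times> Delta_ord a b {2..l}"
      using False by (simp add: sup_params_def Let_def l_def)
    moreover have "0 \<le> \<beta>' j" for j using y(2,3) by (simp add: \<beta>'_def)
    ultimately have "(\<beta>', y) \<in> sup_params n a b"
      using y(1) s' y(3)[rule_format, of a] unfolding iv(1) by (simp add: Delta_c_def)
    moreover have "weighted_sum F (sup_atoms n a b \<beta>' y) = (\<Sum>t\<in>T. w t *\<^sub>R F t)"
    proof -
      have "1 - (\<Sum>j\<in>{1..l}. \<beta>' j) = \<omega> a" using s' by simp
      moreover have "(\<Sum>j\<in>{2..l}. \<beta>' j *\<^sub>R F (y j)) = (\<Sum>j\<in>{2..l}. \<beta> j *\<^sub>R F (y j))"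
        by (intro sum.cong) (auto simp: \<beta>'_def)
      ultimately show ?thesis
        unfolding F e iv(1) using False ab b1
        by (simp add: sup_at e iv(1) atLeastLessThanSuc_atLeastAtMost del: upt_Suc)
    qed
    ultimately show ?thesis by blast
  qed
qed

text \<open>
  For odd \<open>n\<close> there is no endpoint with a weight of its own: the weight left over belongs to \<open>y 1\<close>.
\<close>

lemma inf_atoms_exist:
  fixes F :: "real \<Rightarrow> 'v::real_vector"
  assumes T: "finite T" "T \<subseteq> {a..b}" "card (T - endpoints (1 - n mod 2)) \<le> free_points (1 - n mod 2)"
    and w: "\<And>t. t \<in> T \<Longrightarrow> w t > 0" "sum w T = 1"
  shows "\<exists>(\<beta>, y) \<in> inf_params n a b. weighted_sum F (inf_atoms n a b \<beta> y) = (\<Sum>t\<in>T. w t *\<^sub>R F t)"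
proof -
  define l where "l = (n + 1) div 2"
  show ?thesis
  proof (cases "even n")
    case True
    have e: "1 - n mod 2 = 1" "endpoints 1 = {a}" "free_points 1 = l"
      using True by (auto simp: endpoints_def free_points_def l_def)
    obtain y \<beta> \<omega> where y: "y \<in> Delta_ord a b {1..<1+l}" "\<forall>j. 0 \<le> \<beta> j" "\<forall>t. 0 \<le> \<omega> t"
      and s: "(\<Sum>j\<in>{1..<1+l}. \<beta> j) + sum \<omega> (endpoints 1) = (1::real)"
      and F: "(\<Sum>t\<in>T. w t *\<^sub>R F t)
       = (\<Sum>j\<in>{1..<1+l}. \<beta> j *\<^sub>R F (y j)) + (\<Sum>t\<in>endpoints 1. \<omega> t *\<^sub>R F t)"
      by (rule enumerate_principal[OF T(1,2), of 1 l w 1 F]) (use T(3) w e in auto)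
    have iv: "{1..<1+l} = {1..l}" by auto
    have s': "(\<Sum>j\<in>{1..l}. \<beta> j) + \<omega> a = 1" using s unfolding iv e by simp
    have inf_at: "inf_atoms n a b \<beta> y = (a, 1 - (\<Sum>j=1..l. \<beta> j)) # map (\<lambda>j. (y j, \<beta> j)) [1..<l + 1]" for \<beta> y
      using True by (simp add: inf_atoms_def l_def Let_def)
    have "inf_params n a b = Delta_c {1..l} \<times> Delta_ord a b {1..l}"
      using True by (simp add: inf_params_def Let_def l_def)
    then have "(\<beta>, y) \<in> inf_params n a b"
      using y(1,2) s' y(3)[rule_format, of a] unfolding iv by (simp add: Delta_c_def)
    moreover have "weighted_sum F (inf_atoms n a b \<beta> y) = (\<Sum>t\<in>T. w t *\<^sub>R F t)"
    proof -
      have "1 - (\<Sum>j\<in>{1..l}. \<beta> j) = \<omega> a" using s' by simp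
      then show ?thesis
        unfolding F e using True
        by (simp add: inf_at e iv atLeastLessThanSuc_atLeastAtMost del: upt_Suc)
    qed
    ultimately show ?thesis by blast
  next
    case False
    have e: "1 - n mod 2 = 0" "endpoints 0 = {}" "free_points 0 = l"
      using False by (auto simp: endpoints_def free_points_def l_def odd_iff_mod_2_eq_one)
    have l: "1 \<le> l" using False by (auto simp: l_def elim!: oddE)
    obtain y \<beta> \<omega> where y: "y \<in> Delta_ord a b {1..<1+l}" "\<forall>j. 0 \<le> \<beta> j" "\<forall>t. 0 \<le> (\<omega> t :: real)"
      and s: "(\<Sum>j\<in>{1..<1+l}. \<beta> j) + sum \<omega> (endpoints 0) = (1::real)"
      and F: "(\<Sum>t\<in>T. w t *\<^sub>R F t)
       = (\<Sum>j\<in>{1..<1+l}. \<beta> j *\<^sub>R F (y j)) + (\<Sum>t\<in>endpoints 0. \<omega> t *\<^sub>R F t)"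
      by (rule enumerate_principal[OF T(1,2), of 0 l w 1 F]) (use T(3) w e in auto)
    have iv: "{1..<1+l} = insert 1 {2..l}" "{1..<1+l} = {1..l}" using l by auto
    have s': "\<beta> 1 + (\<Sum>j\<in>{2..l}. \<beta> j) = 1" using s unfolding iv(1) by (simp add: e)
    have inf_at: "inf_atoms n a b \<beta> y = (y 1, 1 - (\<Sum>j=2..l. \<beta> j)) # map (\<lambda>j. (y j, \<beta> j)) [2..<l + 1]" for \<beta> y
      using False by (simp add: inf_atoms_def l_def Let_def)
    have "inf_params n a b = Delta_c {2..l} \<times> Delta_ord a b {1..l}"
      using False by (simp add: inf_params_def Let_def l_def)
    moreover have "(\<Sum>j\<in>{2..l}. \<beta> j) \<le> 1" using s' y(2)[rule_format, of 1] by linarith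
    ultimately have "(\<beta>, y) \<in> inf_params n a b"
      using y(1,2) unfolding iv(2) by (simp add: Delta_c_def)
    moreover have "weighted_sum F (inf_atoms n a b \<beta> y) = (\<Sum>t\<in>T. w t *\<^sub>R F t)"
    proof -
      have "1 - (\<Sum>j\<in>{2..l}. \<beta> j) = \<beta> 1" using s' by simp
      then show ?thesis
        unfolding F e iv(1) using False
        by (simp add: inf_at e atLeastLessThanSuc_atLeastAtMost del: upt_Suc)
    qed
    ultimately show ?thesis by blast
  qed
qed

end

section \<open>Random variables and the extremal values\<close>

lemma rv_in_range: "rv_in a b M Y \<Longrightarrow> \<omega> \<in> space M \<Longrightarrow> Y \<omega> \<in> {a..b}"
  unfolding rv_in_def using measurable_space[of Y M "restrict_space borel {a..b}" \<omega>]
  by (simp add: space_restrict_space)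

lemma rv_in_borel: "rv_in a b M Y \<Longrightarrow> Y \<in> borel_measurable M"
  unfolding rv_in_def by (simp add: measurable_restrict_space2_iff)

lemma integrable_rv_in:
  fixes f :: "real \<Rightarrow> real"
  assumes Y: "rv_in a b M Y" and f: "continuous_on {a..b} f"
  shows "integrable M (\<lambda>\<omega>. f (Y \<omega>))"
proof -
  interpret prob_space M using Y by (simp add: rv_in_def)
  have "bounded (f ` {a..b})"
    using compact_continuous_image[OF f] by (simp add: compact_imp_bounded)
  then obtain B where B: "\<And>t. t \<in> {a..b} \<Longrightarrow> norm (f t) \<le> B"
    unfolding bounded_iff by blast
  show ?thesis
  proof (rule integrable_const_bound)
    show "AE \<omega> in M. norm (f (Y \<omega>)) \<le> B" using B rv_in_range[OF Y] by (intro AE_I2) blast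
    show "(\<lambda>\<omega>. f (Y \<omega>)) \<in> borel_measurable M"
      using Y borel_measurable_continuous_on_restrict[OF f]
      unfolding rv_in_def by (blast intro: measurable_compose)
  qed
qed

text \<open>
  Since \<open>f\<close> need not be measurable outside \<open>[a, b]\<close>, the change of variables is done for its product with the
  indicator function.
\<close>

lemma integral_has_atoms:
  fixes f :: "real \<Rightarrow> real"
  assumes at: "has_atoms a b M Y ps" and wf: "pmf_of_list_wf ps"
    and ps: "fst ` set ps \<subseteq> {a..b}" and f: "continuous_on {a..b} f"
  shows "(\<integral>\<omega>. f (Y \<omega>) \<partial>M) = weighted_sum f ps"
proof -
  define h where "h t = indicat_real {a..b} t *\<^sub>R f t" for t
  have h [measurable]: "h \<in> borel_measurable borel"
    unfolding h_def using f by (intro borel_measurable_continuous_on_indicator) auto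
  have Y: "rv_in a b M Y" and d: "distr M borel Y = distr (measure_pmf (pmf_of_list ps)) borel (\<lambda>t. t)"
    using at by (auto simp: has_atoms_def)
  note [measurable] = rv_in_borel[OF Y]
  have "(\<integral>\<omega>. f (Y \<omega>) \<partial>M) = (\<integral>\<omega>. h (Y \<omega>) \<partial>M)"
    using rv_in_range[OF Y] by (intro Bochner_Integration.integral_cong) (auto simp: h_def)
  also have "\<dots> = (\<integral>t. h t \<partial>distr M borel Y)" by (rule integral_distr[symmetric]) auto
  also have "\<dots> = (\<integral>t. h t \<partial>measure_pmf (pmf_of_list ps))"
    unfolding d by (rule integral_distr) auto
  also have "\<dots> = (\<Sum>t\<in>fst ` set ps. h t * pmf (pmf_of_list ps) t)"
    using set_pmf_of_list[OF wf] by (intro integral_measure_pmf_real) auto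
  also have "\<dots> = (\<Sum>t\<in>fst ` set ps. atom_weight ps t *\<^sub>R f t)"
    using ps by (intro sum.cong) (auto simp: h_def pmf_pmf_of_list[OF wf] atom_weight_def)
  also have "\<dots> = weighted_sum f ps" by (rule weighted_sum_eq_sum[symmetric]) auto
  finally show ?thesis .
qed

text \<open>
  The identity on the discrete distribution, redefined on a null set to take values in \<open>[a, b]\<close> everywhere.
\<close>

lemma has_atoms_exists:
  assumes wf: "pmf_of_list_wf ps" and ps: "fst ` set ps \<subseteq> {a..b}" and ab: "a \<le> b"
  obtains M :: "real measure" and Y where "has_atoms a b M Y ps"
proof -
  let ?M = "measure_pmf (pmf_of_list ps)"
  define Y where "Y t = (if t \<in> {a..b} then t else a)" for t
  have "rv_in a b ?M Y"
    unfolding rv_in_def using ab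
    by (auto intro!: measurable_restrict_space2 simp: Y_def measure_pmf.prob_space_axioms)
  moreover have "distr ?M borel Y = distr ?M borel (\<lambda>t. t)"
  proof (rule distr_cong_AE)
    have "Y t = t" if "t \<in> set_pmf (pmf_of_list ps)" for t
    proof -
      have "t \<in> {a..b}" by (rule subsetD[OF ps], rule subsetD[OF _ that]) (simp add: set_pmf_of_list[OF wf, simplified])
      then show ?thesis unfolding Y_def by (rule if_P)
    qed
    then show "AE t in ?M. Y t = t" by (simp add: AE_measure_pmf_iff)
  qed auto
  ultimately have "has_atoms a b ?M Y ps" by (simp add: has_atoms_def)
  then show ?thesis by (rule that)
qed

context moment_curve
begin

text \<open>
  Otherwise a hyperplane strictly separates the mean from the closed convex moment space, and integrating
  the separating functional along \<open>full_curve (Y \<omega>)\<close> gives a contradiction.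
\<close>

lemma mean_in_moment_space:
  assumes Y: "rv_in a b M Y"
  shows "(mean_curve \<gamma> M Y, \<integral>\<omega>. \<gamma> (CARD('n::{finite,linorder}) + 1) (Y \<omega>) \<partial>M) \<in> moment_space"
    (is "?m \<in> _")
proof (rule ccontr)
  interpret prob_space M using Y by (simp add: rv_in_def)
  assume "?m \<notin> moment_space"
  then obtain c \<beta> where c: "inner c ?m < \<beta>" "\<And>q. q \<in> moment_space \<Longrightarrow> inner c q > \<beta>"
    using separating_hyperplane_closed_point[OF convex_moment_space] compact_moment_space
    by (metis compact_imp_closed)
  have int: "integrable M (\<lambda>\<omega>. \<gamma> (card {..i}) (Y \<omega>))" for i :: 'n
    by (rule integrable_rv_in[OF Y continuous_coordinate])
  have int': "integrable M (\<lambda>\<omega>. \<gamma> (CARD('n) + 1) (Y \<omega>))"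
    by (rule integrable_rv_in[OF Y cont]) simp
  have eq: "inner c (full_curve t)
     = (\<Sum>i\<in>UNIV. vec_nth (fst c) i * \<gamma> (card {..i}) t) + snd c * \<gamma> (CARD('n) + 1) t" for t
    by (cases c) (simp add: full_curve_def inner_vec_def curve_def)
  have "(\<integral>\<omega>. inner c (full_curve (Y \<omega>)) \<partial>M) = inner c ?m"
    unfolding eq using int int'
    by (cases c) (simp add: inner_vec_def mean_curve_def)
  moreover have "(\<integral>\<omega>. inner c (full_curve (Y \<omega>)) \<partial>M) \<ge> \<beta>"
  proof (rule integral_ge_const)
    show "integrable M (\<lambda>\<omega>. inner c (full_curve (Y \<omega>)))"
      unfolding eq using int int' by auto
    show "AE \<omega> in M. \<beta> \<le> inner c (full_curve (Y \<omega>))"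
      using c(2)[OF full_curve_in_moment_space[OF rv_in_range[OF Y]]]
      by (intro AE_I2) (auto intro: less_imp_le)
  qed
  ultimately show False using c(1) by simp
qed

lemma weighted_sum_curve_nth:
  "vec_nth (weighted_sum (curve \<gamma>) ps) (i::'n::{finite,linorder}) = weighted_sum (\<gamma> (card {..i})) ps"
  by (induction ps) (auto simp: curve_def)

lemma mean_curve_has_atoms:
  assumes "has_atoms a b M Y ps" "principal e ps"
  shows "mean_curve \<gamma> M Y = (weighted_sum (curve \<gamma>) ps :: real ^ ('n::{finite,linorder}))"
    and "(\<integral>\<omega>. \<gamma> (CARD('n) + 1) (Y \<omega>) \<partial>M) = weighted_sum (\<gamma> (CARD('n) + 1)) ps"
proof -
  have int: "(\<integral>\<omega>. f (Y \<omega>) \<partial>M) = weighted_sum f ps" if "continuous_on {a..b} f" for f :: "real \<Rightarrow> real"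
    using assms that unfolding principal_def by (intro integral_has_atoms) auto
  show "mean_curve \<gamma> M Y = (weighted_sum (curve \<gamma>) ps :: real ^ ('n::{finite,linorder}))"
    by (auto simp: Finite_Cartesian_Product.vec_eq_iff mean_curve_def weighted_sum_curve_nth
        int[OF continuous_coordinate])
  show "(\<integral>\<omega>. \<gamma> (CARD('n) + 1) (Y \<omega>) \<partial>M) = weighted_sum (\<gamma> (CARD('n) + 1)) ps"
    by (rule int[OF cont]) simp
qed

lemma principal_value_unique:
  assumes e: "e \<le> 1" and ps: "principal e ps" and qs: "principal e qs"
    and eq: "weighted_sum (curve \<gamma>) ps = (weighted_sum (curve \<gamma>) qs :: real ^ ('n::{finite,linorder}))"
  shows "weighted_sum f ps = (weighted_sum f qs :: real)"
proof -
  have fin: "finite (fst ` set xs)" for xs :: "(real \<times> real) list" by simp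
  have wsum: "weighted_sum g xs = (\<Sum>t\<in>fst ` set xs. atom_weight xs t * g t)"
    for g :: "real \<Rightarrow> real" and xs
    using weighted_sum_eq_sum[of "fst ` set xs" xs g] by simp
  have mass: "weighted_sum (\<lambda>_. 1) xs = (1::real)" if "principal e xs" for xs
    using that by (simp add: principal_def pmf_of_list_wf_def weighted_sum_def case_prod_beta')
  have "weighted_sum (with_one \<gamma> i) ps = weighted_sum (with_one \<gamma> i) qs" if i: "i \<le> CARD('n)" for i
  proof (cases "i = 0")
    case True
    then have "with_one \<gamma> i = (\<lambda>_. 1)" by (auto simp: with_one_def)
    then show ?thesis using mass[OF ps] mass[OF qs] by simp
  next
    case False
    then have "i \<in> {1..CARD('n)}" using i by simp
    then obtain j :: 'n where j: "i = card {..j}"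
      using bij_betw_card_atMost[where 'n='n] unfolding bij_betw_def by (metis imageE)
    have "with_one \<gamma> i = \<gamma> i" using False by (auto simp: with_one_def)
    moreover have "weighted_sum (\<gamma> i) ps = weighted_sum (\<gamma> i) qs"
      unfolding j weighted_sum_curve_nth[symmetric] by (simp only: eq)
    ultimately show ?thesis by (simp only:)
  qed
  note moments = this
  show ?thesis
    unfolding wsum
  proof (rule principal_representation_unique[OF e])
    show "(\<Sum>t\<in>fst ` set ps. atom_weight ps t * with_one \<gamma> i t)
        = (\<Sum>t\<in>fst ` set qs. atom_weight qs t * with_one \<gamma> i t)" if "i \<le> CARD('n)" for i
      using moments[OF that] unfolding wsum .
  qed (use ps qs fin in \<open>simp_all only: principal_def\<close>)
qed

text \<open>
  The common core of both extremal problems, for a parameter set \<open>P\<close> whose atoms \<open>A\<close> have the extremal form and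
  give every measure of that form. The extremal measure of \<open>x\<close> is one of them, and by uniqueness every
  other representation of \<open>x\<close> in this form has the same value, so that the definite description \<open>B\<close>
  denotes it.
\<close>

lemma moment_extremum:
  fixes x :: "real ^ ('n::{finite,linorder})" and P :: "('p \<times> 'q) set" and A :: "'p \<Rightarrow> 'q \<Rightarrow> (real \<times> real) list"
  assumes e: "e \<le> 1" and x: "x \<in> convex hull (curve \<gamma> ` {a..b})"
    and prin: "\<And>\<beta> y. (\<beta>, y) \<in> P \<Longrightarrow> principal e (A \<beta> y)"
    and ex: "\<And>T w. finite T \<Longrightarrow> T \<subseteq> {a..b} \<Longrightarrow> card (T - endpoints e) \<le> free_points e \<Longrightarrow>
        (\<And>t. t \<in> T \<Longrightarrow> w t > 0) \<Longrightarrow> sum w T = 1 \<Longrightarrow>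
        \<exists>(\<beta>, y) \<in> P. weighted_sum full_curve (A \<beta> y) = (\<Sum>t\<in>T. w t *\<^sub>R full_curve t)"
    and B: "B = (THE v. \<exists>(\<beta>, y) \<in> P. x = weighted_sum (curve \<gamma>) (A \<beta> y) \<and>
        v = weighted_sum (\<gamma> (CARD('n) + 1)) (A \<beta> y))"
  shows "\<exists>(\<beta>, y) \<in> P. x = weighted_sum (curve \<gamma>) (A \<beta> y)"
    and "(x, v) \<in> moment_space \<Longrightarrow> (-1) ^ (CARD('n) + e) * v \<le> (-1) ^ (CARD('n) + e) * B"
    and "(\<beta>, y) \<in> P \<Longrightarrow> x = weighted_sum (curve \<gamma>) (A \<beta> y) \<Longrightarrow>
       weighted_sum (\<gamma> (CARD('n) + 1)) (A \<beta> y) = B"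
proof -
  let ?g = "\<gamma> (CARD('n) + 1)"
  obtain T w where T: "finite T" "T \<subseteq> {a..b}" "\<forall>t\<in>T. w t > 0" "sum w T = 1"
    and xT: "x = (\<Sum>t\<in>T. w t *\<^sub>R curve \<gamma> t)" "card (T - endpoints e) \<le> free_points e"
    and max: "\<forall>v. (x, v) \<in> moment_space \<longrightarrow>
       (-1) ^ (CARD('n) + e) * v \<le> (-1) ^ (CARD('n) + e) * (\<Sum>t\<in>T. w t * ?g t)"
    by (rule extremal_representation[OF e x]) (rule that)
  obtain \<beta>0 y0 where P0: "(\<beta>0, y0) \<in> P"
    and full: "weighted_sum full_curve (A \<beta>0 y0) = (\<Sum>t\<in>T. w t *\<^sub>R full_curve t)"
    using ex[OF T(1,2) xT(2), of w] T(3,4) by auto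
  have split: "weighted_sum full_curve ps = (weighted_sum (curve \<gamma>) ps, weighted_sum ?g ps)" for ps
    by (induction ps) (auto simp: full_curve_def zero_prod_def)
  have x0: "x = weighted_sum (curve \<gamma>) (A \<beta>0 y0)"
    using arg_cong[OF full, of fst] by (simp add: split xT(1) fst_sum full_curve_def)
  have v0: "weighted_sum ?g (A \<beta>0 y0) = (\<Sum>t\<in>T. w t * ?g t)"
    using arg_cong[OF full, of snd] by (simp add: split snd_sum full_curve_def)
  have uniq: "weighted_sum ?g (A \<beta> y) = weighted_sum ?g (A \<beta>0 y0)"
    if "(\<beta>, y) \<in> P" "x = weighted_sum (curve \<gamma>) (A \<beta> y)" for \<beta> y
    using that x0 P0 by (intro principal_value_unique[OF e]) (auto intro: prin)
  let ?R = "\<lambda>v. \<exists>(\<beta>, y) \<in> P. x = weighted_sum (curve \<gamma>) (A \<beta> y) \<and> v = weighted_sum ?g (A \<beta> y)"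
  have BV: "B = weighted_sum ?g (A \<beta>0 y0)"
    unfolding B
  proof (rule the_equality)
    show "?R (weighted_sum ?g (A \<beta>0 y0))" using P0 x0 by blast
    show "v = weighted_sum ?g (A \<beta>0 y0)" if "?R v" for v using that uniq by blast
  qed
  show "\<exists>(\<beta>, y) \<in> P. x = weighted_sum (curve \<gamma>) (A \<beta> y)" using P0 x0 by blast
  show "(-1) ^ (CARD('n) + e) * v \<le> (-1) ^ (CARD('n) + e) * B" if "(x, v) \<in> moment_space"
    using max that unfolding BV v0 by blast
  show "weighted_sum ?g (A \<beta> y) = B" if "(\<beta>, y) \<in> P" "x = weighted_sum (curve \<gamma>) (A \<beta> y)"
    using uniq[OF that] unfolding BV .
qed

lemma sup_extremum:
  fixes x :: "real ^ ('n::{finite,linorder})"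
  assumes x: "x \<in> convex hull (curve \<gamma> ` {a..b})"
  shows "\<exists>(\<beta>, y) \<in> sup_params CARD('n) a b. x = weighted_sum (curve \<gamma>) (sup_atoms CARD('n) a b \<beta> y)"
    and "(x, v) \<in> moment_space \<Longrightarrow> v \<le> B_sup a b \<gamma> x"
    and "(\<beta>, y) \<in> sup_params CARD('n) a b \<Longrightarrow> x = weighted_sum (curve \<gamma>) (sup_atoms CARD('n) a b \<beta> y) \<Longrightarrow>
       weighted_sum (\<gamma> (CARD('n) + 1)) (sup_atoms CARD('n) a b \<beta> y) = B_sup a b \<gamma> x"
proof -
  have e: "CARD('n) mod 2 \<le> 1" by auto
  have sign: "(-1::real) ^ (CARD('n) + (CARD('n) mod 2)) = 1"
    by (cases "even CARD('n)") (simp_all add: odd_iff_mod_2_eq_one)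
  note extremum = moment_extremum[OF e x principal_sup_atoms sup_atoms_exist B_sup_def, unfolded sign]
  show "\<exists>(\<beta>, y) \<in> sup_params CARD('n) a b. x = weighted_sum (curve \<gamma>) (sup_atoms CARD('n) a b \<beta> y)"
    by (rule extremum(1))
  show "v \<le> B_sup a b \<gamma> x" if "(x, v) \<in> moment_space"
  proof -
    have "1 * v \<le> 1 * B_sup a b \<gamma> x" using that by (intro extremum(2))
    then show ?thesis by simp
  qed
  show "weighted_sum (\<gamma> (CARD('n) + 1)) (sup_atoms CARD('n) a b \<beta> y) = B_sup a b \<gamma> x"
    if "(\<beta>, y) \<in> sup_params CARD('n) a b" "x = weighted_sum (curve \<gamma>) (sup_atoms CARD('n) a b \<beta> y)"
    by (rule extremum(3)) (use that in auto)
qed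

lemma inf_extremum:
  fixes x :: "real ^ ('n::{finite,linorder})"
  assumes x: "x \<in> convex hull (curve \<gamma> ` {a..b})"
  shows "\<exists>(\<beta>, y) \<in> inf_params CARD('n) a b. x = weighted_sum (curve \<gamma>) (inf_atoms CARD('n) a b \<beta> y)"
    and "(x, v) \<in> moment_space \<Longrightarrow> B_inf a b \<gamma> x \<le> v"
    and "(\<beta>, y) \<in> inf_params CARD('n) a b \<Longrightarrow> x = weighted_sum (curve \<gamma>) (inf_atoms CARD('n) a b \<beta> y) \<Longrightarrow>
       weighted_sum (\<gamma> (CARD('n) + 1)) (inf_atoms CARD('n) a b \<beta> y) = B_inf a b \<gamma> x"
proof -
  have e: "1 - CARD('n) mod 2 \<le> 1" by auto
  have sign: "(-1::real) ^ (CARD('n) + (1 - CARD('n) mod 2)) = -1"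
    by (cases "even CARD('n)") (simp_all add: odd_iff_mod_2_eq_one)
  note extremum = moment_extremum[OF e x principal_inf_atoms inf_atoms_exist B_inf_def, unfolded sign]
  show "\<exists>(\<beta>, y) \<in> inf_params CARD('n) a b. x = weighted_sum (curve \<gamma>) (inf_atoms CARD('n) a b \<beta> y)"
    by (rule extremum(1))
  show "B_inf a b \<gamma> x \<le> v" if "(x, v) \<in> moment_space"
  proof -
    have "-1 * v \<le> - 1 * B_inf a b \<gamma> x" using that by (intro extremum(2))
    then show ?thesis by simp
  qed
  show "weighted_sum (\<gamma> (CARD('n) + 1)) (inf_atoms CARD('n) a b \<beta> y) = B_inf a b \<gamma> x"
    if "(\<beta>, y) \<in> inf_params CARD('n) a b" "x = weighted_sum (curve \<gamma>) (inf_atoms CARD('n) a b \<beta> y)"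
    by (rule extremum(3)) (use that in auto)
qed

lemma moment_values_bounds:
  fixes x :: "real ^ ('n::{finite,linorder})"
  assumes x: "x \<in> convex hull (curve \<gamma> ` {a..b})"
  shows "moment_values TYPE('w) a b \<gamma> x \<subseteq> {B_inf a b \<gamma> x..B_sup a b \<gamma> x}"
proof
  fix v assume "v \<in> moment_values TYPE('w) a b \<gamma> x"
  then obtain M :: "'w measure" and Y where "rv_in a b M Y" "mean_curve \<gamma> M Y = x"
    and v: "v = (\<integral>\<omega>. \<gamma> (CARD('n) + 1) (Y \<omega>) \<partial>M)"
    by (auto simp: moment_values_def)
  then have "(x, v) \<in> moment_space" using mean_in_moment_space[of M Y] by simp
  then show "v \<in> {B_inf a b \<gamma> x..B_sup a b \<gamma> x}"
    using sup_extremum(2)[OF x] inf_extremum(2)[OF x] by simp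
qed

lemma sup_atoms_attain:
  fixes x :: "real ^ ('n::{finite,linorder})" and M :: "'w measure"
  assumes x: "x \<in> convex hull (curve \<gamma> ` {a..b})"
    and p: "(\<beta>, y) \<in> sup_params CARD('n) a b" "x = weighted_sum (curve \<gamma>) (sup_atoms CARD('n) a b \<beta> y)"
    and M: "has_atoms a b M Y (sup_atoms CARD('n) a b \<beta> y)"
  shows "mean_curve \<gamma> M Y = x \<and> (\<integral>\<omega>. \<gamma> (CARD('n) + 1) (Y \<omega>) \<partial>M) = B_sup a b \<gamma> x"
  using mean_curve_has_atoms[OF M principal_sup_atoms[OF p(1)]] sup_extremum(3)[OF x p] p(2) by simp

lemma sup_atoms_attain_real:
  fixes x :: "real ^ ('n::{finite,linorder})"
  assumes x: "x \<in> convex hull (curve \<gamma> ` {a..b})"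
    and p: "(\<beta>, y) \<in> sup_params CARD('n) a b" "x = weighted_sum (curve \<gamma>) (sup_atoms CARD('n) a b \<beta> y)"
  shows "\<exists>(M :: real measure) Y. has_atoms a b M Y (sup_atoms CARD('n) a b \<beta> y) \<and>
     mean_curve \<gamma> M Y = x \<and> (\<integral>\<omega>. \<gamma> (CARD('n) + 1) (Y \<omega>) \<partial>M) = B_sup a b \<gamma> x"
proof -
  have "pmf_of_list_wf (sup_atoms CARD('n) a b \<beta> y)" "fst ` set (sup_atoms CARD('n) a b \<beta> y) \<subseteq> {a..b}"
    using principal_sup_atoms[OF p(1)] by (auto simp only: principal_def)
  then obtain M :: "real measure" and Y where M: "has_atoms a b M Y (sup_atoms CARD('n) a b \<beta> y)"
    using less_imp_le[OF ab] by (rule has_atoms_exists)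
  show ?thesis using M sup_atoms_attain[OF x p M] by blast
qed

lemma B_sup_in_moment_values:
  fixes x :: "real ^ ('n::{finite,linorder})"
  assumes x: "x \<in> convex hull (curve \<gamma> ` {a..b})"
  shows "B_sup a b \<gamma> x \<in> moment_values TYPE(real) a b \<gamma> x"
proof -
  obtain \<beta> y where p: "(\<beta>, y) \<in> sup_params CARD('n) a b" "x = weighted_sum (curve \<gamma>) (sup_atoms CARD('n) a b \<beta> y)"
    using sup_extremum(1)[OF x] by blast
  obtain M :: "real measure" and Y where "has_atoms a b M Y (sup_atoms CARD('n) a b \<beta> y)"
    "mean_curve \<gamma> M Y = x" "(\<integral>\<omega>. \<gamma> (CARD('n) + 1) (Y \<omega>) \<partial>M) = B_sup a b \<gamma> x"
    using sup_atoms_attain_real[OF x p] by blast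
  then show ?thesis unfolding moment_values_def has_atoms_def
    by (intro CollectI exI[of _ M] exI[of _ Y]) simp
qed

lemma inf_atoms_attain:
  fixes x :: "real ^ ('n::{finite,linorder})" and M :: "'w measure"
  assumes x: "x \<in> convex hull (curve \<gamma> ` {a..b})"
    and p: "(\<beta>, y) \<in> inf_params CARD('n) a b" "x = weighted_sum (curve \<gamma>) (inf_atoms CARD('n) a b \<beta> y)"
    and M: "has_atoms a b M Y (inf_atoms CARD('n) a b \<beta> y)"
  shows "mean_curve \<gamma> M Y = x \<and> (\<integral>\<omega>. \<gamma> (CARD('n) + 1) (Y \<omega>) \<partial>M) = B_inf a b \<gamma> x"
  using mean_curve_has_atoms[OF M principal_inf_atoms[OF p(1)]] inf_extremum(3)[OF x p] p(2) by simp

lemma inf_atoms_attain_real: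
  fixes x :: "real ^ ('n::{finite,linorder})"
  assumes x: "x \<in> convex hull (curve \<gamma> ` {a..b})"
    and p: "(\<beta>, y) \<in> inf_params CARD('n) a b" "x = weighted_sum (curve \<gamma>) (inf_atoms CARD('n) a b \<beta> y)"
  shows "\<exists>(M :: real measure) Y. has_atoms a b M Y (inf_atoms CARD('n) a b \<beta> y) \<and>
     mean_curve \<gamma> M Y = x \<and> (\<integral>\<omega>. \<gamma> (CARD('n) + 1) (Y \<omega>) \<partial>M) = B_inf a b \<gamma> x"
proof -
  have "pmf_of_list_wf (inf_atoms CARD('n) a b \<beta> y)" "fst ` set (inf_atoms CARD('n) a b \<beta> y) \<subseteq> {a..b}"
    using principal_inf_atoms[OF p(1)] by (auto simp only: principal_def)
  then obtain M :: "real measure" and Y where M: "has_atoms a b M Y (inf_atoms CARD('n) a b \<beta> y)"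
    using less_imp_le[OF ab] by (rule has_atoms_exists)
  show ?thesis using M inf_atoms_attain[OF x p M] by blast
qed

lemma B_inf_in_moment_values:
  fixes x :: "real ^ ('n::{finite,linorder})"
  assumes x: "x \<in> convex hull (curve \<gamma> ` {a..b})"
  shows "B_inf a b \<gamma> x \<in> moment_values TYPE(real) a b \<gamma> x"
proof -
  obtain \<beta> y where p: "(\<beta>, y) \<in> inf_params CARD('n) a b" "x = weighted_sum (curve \<gamma>) (inf_atoms CARD('n) a b \<beta> y)"
    using inf_extremum(1)[OF x] by blast
  obtain M :: "real measure" and Y where "has_atoms a b M Y (inf_atoms CARD('n) a b \<beta> y)"
    "mean_curve \<gamma> M Y = x" "(\<integral>\<omega>. \<gamma> (CARD('n) + 1) (Y \<omega>) \<partial>M) = B_inf a b \<gamma> x"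
    using inf_atoms_attain_real[OF x p] by blast
  then show ?thesis unfolding moment_values_def has_atoms_def
    by (intro CollectI exI[of _ M] exI[of _ Y]) simp
qed

lemma SUP_INF_moment_values:
  fixes x :: "real ^ ('n::{finite,linorder})"
  assumes x: "x \<in> convex hull (curve \<gamma> ` {a..b})"
  shows "(SUP v \<in> moment_values TYPE(real) a b \<gamma> x. ereal v) = ereal (B_sup a b \<gamma> x)"
    and "(INF v \<in> moment_values TYPE(real) a b \<gamma> x. ereal v) = ereal (B_inf a b \<gamma> x)"
proof -
  have "B_inf a b \<gamma> x \<le> v \<and> v \<le> B_sup a b \<gamma> x" if "v \<in> moment_values TYPE(real) a b \<gamma> x" for v
    using moment_values_bounds[OF x, where 'w=real] that by auto
  then show "(SUP v \<in> moment_values TYPE(real) a b \<gamma> x. ereal v) = ereal (B_sup a b \<gamma> x)"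
    and "(INF v \<in> moment_values TYPE(real) a b \<gamma> x. ereal v) = ereal (B_inf a b \<gamma> x)"
    by (auto intro!: antisym SUP_least INF_greatest SUP_upper INF_lower
        B_sup_in_moment_values[OF x] B_inf_in_moment_values[OF x])
qed

end

theorem theorem2p3:
  fixes \<gamma> :: "nat \<Rightarrow> real \<Rightarrow> real" and a b :: real and n :: nat
    and x :: "real ^ ('n::{finite,linorder})"
  assumes n: "n = CARD('n)"
    and ab: "a < b"
    and cont: "\<And>i. i \<in> {1..n+1} \<Longrightarrow> continuous_on {a..b} (\<gamma> i)"
    and smooth: "\<And>i. i \<in> {1..n+1} \<Longrightarrow> Ck_on (n+1) (\<gamma> i) {a<..<b}"
    and minors: "\<And>k t. k \<in> {1..n+1} \<Longrightarrow> t \<in> {a<..<b} \<Longrightarrow>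
                   leading_principal_minor (deriv_matrix (n+1) \<gamma> t) k > 0"
    and x: "x \<in> convex hull (curve \<gamma> ` {a..b})"
  shows "
      ((SUP v \<in> moment_values TYPE(real) a b \<gamma> x. ereal v) = ereal (B_sup a b \<gamma> x)) \<and>
      ((INF v \<in> moment_values TYPE(real) a b \<gamma> x. ereal v) = ereal (B_inf a b \<gamma> x)) \<and>
      \<comment> \<open>no sample space, of whatever type, gives a value beyond these bounds\<close>
      (moment_values TYPE('w) a b \<gamma> x \<subseteq> {B_inf a b \<gamma> x .. B_sup a b \<gamma> x}) \<and>
      \<comment> \<open>the extremal representations exist, and every one of them attains the bound\<close>
      (\<exists>(\<beta>, y) \<in> sup_params n a b. x = weighted_sum (curve \<gamma>) (sup_atoms n a b \<beta> y)) \<and>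
      (\<forall>(\<beta>, y) \<in> sup_params n a b. x = weighted_sum (curve \<gamma>) (sup_atoms n a b \<beta> y) \<longrightarrow>
           (\<exists>(M :: real measure) \<zeta>. has_atoms a b M \<zeta> (sup_atoms n a b \<beta> y) \<and>
              mean_curve \<gamma> M \<zeta> = x \<and> (\<integral>\<omega>. \<gamma> (n+1) (\<zeta> \<omega>) \<partial>M) = B_sup a b \<gamma> x) \<and>
           (\<forall>(M :: 'w measure) \<zeta>. has_atoms a b M \<zeta> (sup_atoms n a b \<beta> y) \<longrightarrow>
              mean_curve \<gamma> M \<zeta> = x \<and> (\<integral>\<omega>. \<gamma> (n+1) (\<zeta> \<omega>) \<partial>M) = B_sup a b \<gamma> x)) \<and>
      (\<exists>(\<beta>, y) \<in> inf_params n a b. x = weighted_sum (curve \<gamma>) (inf_atoms n a b \<beta> y)) \<and>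
      (\<forall>(\<beta>, y) \<in> inf_params n a b. x = weighted_sum (curve \<gamma>) (inf_atoms n a b \<beta> y) \<longrightarrow>
           (\<exists>(M :: real measure) \<xi>. has_atoms a b M \<xi> (inf_atoms n a b \<beta> y) \<and>
              mean_curve \<gamma> M \<xi> = x \<and> (\<integral>\<omega>. \<gamma> (n+1) (\<xi> \<omega>) \<partial>M) = B_inf a b \<gamma> x) \<and>
           (\<forall>(M :: 'w measure) \<xi>. has_atoms a b M \<xi> (inf_atoms n a b \<beta> y) \<longrightarrow>
              mean_curve \<gamma> M \<xi> = x \<and> (\<integral>\<omega>. \<gamma> (n+1) (\<xi> \<omega>) \<partial>M) = B_inf a b \<gamma> x))"
proof -
  interpret moment_curve \<gamma> a b "TYPE('n)"
  proof (rule moment_curve.intro)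
    show "continuous_on {a..b} (\<gamma> i)" if "i \<in> {1..CARD('n) + 1}" for i using cont that n by simp
    show "chebyshev_pair (with_one \<gamma>) CARD('n) a b"
    proof (rule chebyshev_pair.intro)
      show "Determinant.det (colloc (Suc k) (with_one \<gamma>) t) > 0"
        if "k \<in> {CARD('n), CARD('n) + 1}" "strict_mono_on {..k} t" "\<And>j. j \<le> k \<Longrightarrow> t j \<in> {a..b}" for k t
        using that n by (intro minors_pos_imp_colloc_pos[OF cont smooth minors]) auto
    qed (rule ab)
  qed
  show ?thesis
    using SUP_INF_moment_values[OF x] moment_values_bounds[OF x, where 'w='w] sup_extremum(1)[OF x] inf_extremum(1)[OF x]
      sup_atoms_attain_real[OF x] inf_atoms_attain_real[OF x]
      sup_atoms_attain[OF x, where 'w='w] inf_atoms_attain[OF x, where 'w='w]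
    unfolding n by (intro conjI) (simp_all only:, blast+)
qed

end
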